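(* Let $s\in(0,1)$ and let $f$ be a function on $\mathbb{T}^2$ whose Fourier coefficients satisfy, for some constant $C$, all $m\in\mathbb{Z}^2$ and $i=1,2$, $$|\widehat f(m)|\le\frac{C}{\langle m\rangle^{1+s}},\qquad|\sigma_m^i(f)|\le\frac{C}{\langle m\rangle^{2+s}},\qquad|\sigma_m(f)|\le\frac{C}{\langle m\rangle^{3+s}}.\qquad( * )$$ Let $u(x,t)=\sum_{m\in\mathbb{Z}^2}e^{i|m|^2t}\widehat f(m)e^{im\cdot x}$. (i) For almost every $t$, $u(\cdot,t)\in C^{\gamma'}(\mathbb{T}^2)$ for every $0<\gamma'<s$, and hence $\dim_t(f)\le3-s$. (ii) Let $r_0=\sup\{r:f\in H^r(\mathbb{T}^2)\}$. Then for almost every $t$ such that $u(\cdot,t)$ is continuous, $\dim_t(f)\ge3+s-2r_0$. In particular, if $f$ satisfies $( * )$ with $s=\frac12$ and $f\notin H^{1/2}(\mathbb{T}^2)$, then $\dim_t(f)=\frac52$ for almost every $t$.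
   Context: $\mathbb{T}^2=(\mathbb{R}/2\pi\mathbb{Z})^2$; $\widehat f(m)$, $m=(m_1,m_2)\in\mathbb{Z}^2$, are the Fourier coefficients; $\langle m\rangle=(1+|m|^2)^{1/2}$. The differences are $$\sigma_m(f)=\widehat f(m_1+1,m_2+1)-\widehat f(m_1+1,m_2)-\widehat f(m_1,m_2+1)+\widehat f(m_1,m_2),$$ $$\sigma^1_m(f)=\widehat f(m_1+1,m_2)-\widehat f(m_1,m_2),\qquad\sigma_m^2(f)=\widehat f(m_1,m_2+1)-\widehat f(m_1,m_2).$$ The fractal (upper Minkowski) dimension of a bounded set $E$ is $\limsup_{\epsilon\to0}\frac{\log\mathcal N(E,\epsilon)}{\log(1/\epsilon)}$, where $\mathcal N(E,\epsilon)$ is the minimum number of boxes of sidelength $\epsilon$ needed to cover $E$. $\dim_t(f)$ denotes the maximum of the fractal dimensions of the graphs of the real and imaginary parts of $u(\cdot,t)$. $C^{\gamma'}$ is the Hölder space. *)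

theory Defs
  imports "HOL-Analysis.Analysis"
begin

text \<open>Functions on the torus are represented by functions on the plane that are
  \<open>2\<pi>\<close>-periodic in each variable.\<close>

definition torus_periodic :: "(real \<times> real \<Rightarrow> 'b) \<Rightarrow> bool" where
  "torus_periodic f \<longleftrightarrow>
     (\<forall>x y. f (x + 2 * pi, y) = f (x, y) \<and> f (x, y + 2 * pi) = f (x, y))"

definition torus_square :: "(real \<times> real) set" where
  "torus_square = cbox (0, 0) (2 * pi, 2 * pi)"

definition torus_L1 :: "(real \<times> real \<Rightarrow> complex) \<Rightarrow> bool" where
  "torus_L1 f \<longleftrightarrow> torus_periodic f \<and> set_integrable lebesgue torus_square f"

definition torus_L2 :: "(real \<times> real \<Rightarrow> complex) \<Rightarrow> bool" where
  "torus_L2 f \<longleftrightarrow> torus_periodic f \<and> set_borel_measurable lebesgue torus_square f \<and>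
     set_integrable lebesgue torus_square (\<lambda>x. (norm (f x))\<^sup>2)"

definition character :: "int \<times> int \<Rightarrow> real \<times> real \<Rightarrow> complex" where
  "character m x = exp (\<i> * complex_of_real (of_int (fst m) * fst x + of_int (snd m) * snd x))"

definition fourier_coeff :: "(real \<times> real \<Rightarrow> complex) \<Rightarrow> int \<times> int \<Rightarrow> complex" where
  "fourier_coeff f m =
     (LINT x:torus_square|lebesgue. f x * cnj (character m x)) / complex_of_real ((2 * pi)\<^sup>2)"

definition normsq :: "int \<times> int \<Rightarrow> real" where
  "normsq m = (of_int (fst m))\<^sup>2 + (of_int (snd m))\<^sup>2"

definition bracket :: "int \<times> int \<Rightarrow> real" where
  "bracket m = sqrt (1 + normsq m)"

definition sigma :: "(real \<times> real \<Rightarrow> complex) \<Rightarrow> int \<times> int \<Rightarrow> complex" where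
  "sigma f = (\<lambda>(m1, m2).
     fourier_coeff f (m1 + 1, m2 + 1) - fourier_coeff f (m1 + 1, m2)
     - fourier_coeff f (m1, m2 + 1) + fourier_coeff f (m1, m2))"

definition sigma1 :: "(real \<times> real \<Rightarrow> complex) \<Rightarrow> int \<times> int \<Rightarrow> complex" where
  "sigma1 f = (\<lambda>(m1, m2). fourier_coeff f (m1 + 1, m2) - fourier_coeff f (m1, m2))"

definition sigma2 :: "(real \<times> real \<Rightarrow> complex) \<Rightarrow> int \<times> int \<Rightarrow> complex" where
  "sigma2 f = (\<lambda>(m1, m2). fourier_coeff f (m1, m2 + 1) - fourier_coeff f (m1, m2))"

text \<open>A function \<open>v\<close> is a version of \<open>u(\<cdot>,t)\<close> if the series defining \<open>u(\<cdot>,t)\<close> converges to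
  \<open>v\<close> unconditionally in \<open>L\<^sup>2\<close> of the torus.  (The series need not converge absolutely at any
  point, so \<open>u(\<cdot>,t)\<close> is a priori only an almost-everywhere class.)\<close>

definition evolution_version ::
    "(real \<times> real \<Rightarrow> complex) \<Rightarrow> real \<Rightarrow> (real \<times> real \<Rightarrow> complex) \<Rightarrow> bool" where
  "evolution_version f t v \<longleftrightarrow> torus_L2 v \<and>
     ((\<lambda>F. LINT x:torus_square|lebesgue.
         (norm ((\<Sum>m\<in>F. exp (\<i> * complex_of_real (normsq m * t)) * fourier_coeff f m
                   * character m x) - v x))\<^sup>2)
       \<longlongrightarrow> 0) (finite_subsets_at_top UNIV)"

text \<open>The continuous version is chosen whenever there is one; it is then unique.\<close>

definition evolution :: "(real \<times> real \<Rightarrow> complex) \<Rightarrow> real \<Rightarrow> real \<times> real \<Rightarrow> complex" where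
  "evolution f t = (SOME v. evolution_version f t v \<and>
     (continuous_on UNIV v \<or> \<not> (\<exists>w. evolution_version f t w \<and> continuous_on UNIV w)))"

definition torus_Holder :: "real \<Rightarrow> (real \<times> real \<Rightarrow> complex) \<Rightarrow> bool" where
  "torus_Holder \<gamma> v \<longleftrightarrow> torus_periodic v \<and>
     (\<exists>K. \<forall>x y. norm (v x - v y) \<le> K * dist x y powr \<gamma>)"

definition in_sobolev :: "real \<Rightarrow> (real \<times> real \<Rightarrow> complex) \<Rightarrow> bool" where
  "in_sobolev r f \<longleftrightarrow>
     (\<lambda>m. bracket m powr (2 * r) * (norm (fourier_coeff f m))\<^sup>2) summable_on UNIV"

text \<open>Extended-real valued: the supremum is infinite if \<open>f\<close> is smooth.\<close>

definition sobolev_index :: "(real \<times> real \<Rightarrow> complex) \<Rightarrow> ereal" where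
  "sobolev_index f = Sup (ereal ` {r. in_sobolev r f})"

text \<open>Meaningful for bounded \<open>E\<close> and positive \<open>\<epsilon>\<close>, when a finite cover exists.\<close>

definition covering_number :: "'a::euclidean_space set \<Rightarrow> real \<Rightarrow> nat" where
  "covering_number E \<epsilon> =
     (LEAST n. \<exists>A. finite A \<and> card A = n \<and> E \<subseteq> (\<Union>a\<in>A. cbox a (a + \<epsilon> *\<^sub>R One)))"

definition fractal_dim :: "'a::euclidean_space set \<Rightarrow> ereal" where
  "fractal_dim E =
     Limsup (at_right 0) (\<lambda>\<epsilon>. ereal (ln (real (covering_number E \<epsilon>)) / ln (1 / \<epsilon>)))"

definition torus_graph :: "(real \<times> real \<Rightarrow> real) \<Rightarrow> ((real \<times> real) \<times> real) set" where
  "torus_graph g = (\<lambda>x. (x, g x)) ` torus_square"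

definition dim_t :: "real \<Rightarrow> (real \<times> real \<Rightarrow> complex) \<Rightarrow> ereal" where
  "dim_t t f = max (fractal_dim (torus_graph (\<lambda>x. Re (evolution f t x))))
                   (fractal_dim (torus_graph (\<lambda>x. Im (evolution f t x))))"

end

theory Submission
  imports Defs
begin

text \<open>
  Weyl differencing bounds a quadratic exponential sum of length \<open>L\<close> by
  \<open>L + 2 (\<Sum>h<L. min L (1 / \<bar>sin (h t)\<bar>))\<close>.  Since \<open>min L y \<le> L\<^sup>e y\<^bsup>1-e\<^esup>\<close>, and since the series
  \<open>\<Sum>h. h\<^bsup>-1-e\<^esup> \<bar>sin (h t)\<bar>\<^bsup>-(1-e)\<^esup>\<close> is locally integrable in \<open>t\<close>, for almost every \<open>t\<close> these sums
  are \<open>O(L\<^bsup>1/2+e\<^esup>)\<close> uniformly in the linear phase, and no Diophantine approximation is needed.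
  Summation by parts in both variables on dyadic shells then gives \<open>O(2\<^bsup>-j(s-2e)\<^esup>)\<close> for the \<open>j\<close>-th
  shell of \<open>u(x,t)\<close>, with Lipschitz constant \<open>2\<^sup>j\<close> times that; hence Hoelder continuity and the
  upper bound for the dimension.

  For the lower bound, a cover of the graph by \<open>N\<close> cubes of side \<open>\<epsilon>\<close> controls the \<open>L\<^sup>1\<close> modulus of
  continuity by a multiple of \<open>\<epsilon>\<^sup>3 N\<close>.  Multiplied by the Hoelder bound this controls the \<open>L\<^sup>2\<close>
  modulus of continuity, which by Parseval's identity gives Sobolev regularity of \<open>f\<close>.
\<close>

section \<open>Quadratic exponential sums\<close>

text \<open>The function 1 / |sin| just fails to be locally integrable. The power 1 - e repairs this
  at the price of a factor L^e, and the summable weight h^(-1-e) costs a further L^(1+e); hence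
  L^(1+2e) for the squared sum. On a shell two such sums of length 2^j are multiplied, giving
  2^(j(1+2e)) against coefficients of size 2^(-j(1+s)). The decay of the coefficients alone does not
  force absolute convergence. The continuous function is therefore built as a uniform limit along
  dyadic squares, and must then be matched with the version chosen in \<open>evolution\<close>,
  which is specified by unconditional convergence in mean square. For the lower bound, a Hoelder
  exponent \<gamma> < s and dimension below d make the squared mean-square modulus of continuity
  O(\<epsilon>^(\<gamma>+3-d)). Since the factors e^(i|m|^2 t) have modulus 1, this is a statement
  on the coefficients of f: it gives H^r for 2r < \<gamma>+3-d, so \<gamma> tending to s yields 2
  r_0 \<ge> 3+s-d.\<close>

lemma norm_add_squared: "(norm (a + b))\<^sup>2 = (norm a)\<^sup>2 + (norm b)\<^sup>2 + 2 * Re (b * cnj a)" for a b :: complex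
  unfolding cmod_power2 by (simp add: power2_eq_square algebra_simps)

text \<open>Weyl differencing: the off-diagonal products are grouped by the difference
  \<open>h\<close> of their indices, and the groups for \<open>h\<close> and -\<open>h\<close> are
  conjugate, whence twice a real part. Appending \<open>z L\<close> adds one product to each
  group.\<close>

lemma norm_sum_squared:
  fixes z :: "nat \<Rightarrow> complex"
  shows "(norm (\<Sum>k<L. z k))\<^sup>2 =
    (\<Sum>k<L. (norm (z k))\<^sup>2) + 2 * Re (\<Sum>h\<in>{1..<L}. \<Sum>l<L - h. z (l + h) * cnj (z l))"
proof (induction L)
  case 0
  then show ?case by simp
next
  case (Suc L)
  have "(\<Sum>h\<in>{1..<Suc L}. \<Sum>l<Suc L - h. z (l + h) * cnj (z l))
      = (\<Sum>h\<in>{1..<Suc L}. (\<Sum>l<L - h. z (l + h) * cnj (z l)) + z L * cnj (z (L - h)))"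
    by (rule sum.cong) (auto simp: Suc_diff_le)
  also have "\<dots> = (\<Sum>h\<in>{1..<Suc L}. \<Sum>l<L - h. z (l + h) * cnj (z l))
                 + (\<Sum>h\<in>{1..<Suc L}. z L * cnj (z (L - h)))"
    by (rule sum.distrib)
  also have "(\<Sum>h\<in>{1..<Suc L}. \<Sum>l<L - h. z (l + h) * cnj (z l))
           = (\<Sum>h\<in>{1..<L}. \<Sum>l<L - h. z (l + h) * cnj (z l))"
    by (rule sum.mono_neutral_right) (auto simp: less_Suc_eq)
  also have "(\<Sum>h\<in>{1..<Suc L}. z L * cnj (z (L - h))) = (\<Sum>l<L. z L * cnj (z l))"
    by (rule sum.reindex_bij_witness[of _ "\<lambda>l. L - l" "\<lambda>h. L - h"]) auto
  finally have *: "Re (\<Sum>h\<in>{1..<Suc L}. \<Sum>l<Suc L - h. z (l + h) * cnj (z l))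
     = Re (\<Sum>h\<in>{1..<L}. \<Sum>l<L - h. z (l + h) * cnj (z l)) + Re (z L * cnj (\<Sum>l<L. z l))"
    by (simp add: sum_distrib_left)
  have "(norm (\<Sum>k<Suc L. z k))\<^sup>2
      = (norm (\<Sum>k<L. z k))\<^sup>2 + (norm (z L))\<^sup>2 + 2 * Re (z L * cnj (\<Sum>l<L. z l))"
      by (simp only: sum.lessThan_Suc norm_add_squared)
  with Suc * show ?case by simp
qed

lemma norm_cis_minus_one: "norm (cis \<theta> - 1) = 2 * \<bar>sin (\<theta> / 2)\<bar>"
  using dist_exp_i_1[of \<theta>] by (simp add: dist_norm cis_conv_exp)

lemma norm_cis_minus_one_le: "norm (cis \<theta> - 1) \<le> \<bar>\<theta>\<bar>"
  using abs_sin_x_le_abs_x[of "\<theta> / 2"] by (simp add: norm_cis_minus_one)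

lemma norm_geometric_sum_le:
  assumes "sin \<theta> \<noteq> 0"
  shows "norm (\<Sum>l<n. cis (2 * \<theta>) ^ l) \<le> 1 / \<bar>sin \<theta>\<bar>"
proof -
  have n: "norm (1 - cis (2 * \<theta>)) = 2 * \<bar>sin \<theta>\<bar>"
    using norm_cis_minus_one[of "2 * \<theta>"] by (simp add: norm_minus_commute)
  then have ne: "cis (2 * \<theta>) \<noteq> 1" using assms by auto
  have "norm (1 - cis (2 * \<theta>) ^ n) \<le> 1 + 1"
    by (rule order_trans[OF norm_triangle_ineq4]) (simp add: norm_power)
  then show ?thesis
    using assms ne n by (simp add: sum_gp_strict norm_divide field_simps)
qed

text \<open>Used in two places: to trade the trivial bound against the pole of 1 / |sin|, and to
  interpolate between the size and the Lipschitz bound of a shell.\<close>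

lemma min_le_weighted_geometric_mean:
  fixes a b :: real
  assumes "0 < a" "0 < b" "0 \<le> e" "e \<le> 1"
  shows "min a b \<le> a powr e * b powr (1 - e)"
proof -
  have "min a b = min a b powr e * min a b powr (1 - e)"
    using assms by (simp flip: powr_add)
  also have "\<dots> \<le> a powr e * b powr (1 - e)"
    using assms by (intro mult_mono powr_mono2) auto
  finally show ?thesis .
qed

lemma quadratic_exponential_sum_le:
  fixes t x :: real and M :: int
  assumes nz: "\<And>h. 0 < h \<Longrightarrow> sin (real h * t) \<noteq> 0"
    and e: "0 \<le> e" "e \<le> 1"
    and G: "\<And>L. (\<Sum>h\<in>{1..<L}. real h powr - (1 + e) * \<bar>sin (real h * t)\<bar> powr - (1 - e)) \<le> G"
  shows "norm (\<Sum>k<L. cis (t * (of_int (M + int k))\<^sup>2 + x * of_int (M + int k)))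
    \<le> sqrt (1 + 2 * G) * real L powr (1/2 + e)"
proof (cases "L = 0")
  case False
  define z where "z k = cis (t * (of_int (M + int k))\<^sup>2 + x * of_int (M + int k))" for k
  have G0: "0 \<le> G" using G[of 0] by simp
  have prod: "z (l + h) * cnj (z l)
      = cis (t * (real h)\<^sup>2 + x * real h + 2 * t * real h * of_int M) * cis (2 * (real h * t)) ^ l" for l h
    unfolding z_def by (simp add: cis_cnj cis_mult Complex.DeMoivre power2_eq_square algebra_simps)
  have inner: "Re (\<Sum>l<L - h. z (l + h) * cnj (z l))
      \<le> real L powr (1 + 2 * e) * (real h powr - (1 + e) * \<bar>sin (real h * t)\<bar> powr - (1 - e))"
    if h: "h \<in> {1..<L}" for h
  proof -
    have hp: "0 < h" "h < L" using h by auto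
    have eq: "norm (\<Sum>l<L - h. z (l + h) * cnj (z l)) = norm (\<Sum>l<L - h. cis (2 * (real h * t)) ^ l)"
      unfolding prod by (simp flip: sum_distrib_left add: norm_mult)
    have "norm (\<Sum>l<L - h. cis (2 * (real h * t)) ^ l) \<le> (\<Sum>l<L - h. 1)"
      by (rule order_trans[OF norm_sum]) (simp add: norm_power)
    then have 1: "norm (\<Sum>l<L - h. cis (2 * (real h * t)) ^ l) \<le> real L" by simp
    have 2: "norm (\<Sum>l<L - h. cis (2 * (real h * t)) ^ l) \<le> 1 / \<bar>sin (real h * t)\<bar>"
      using norm_geometric_sum_le nz hp by blast
    have "Re (\<Sum>l<L - h. z (l + h) * cnj (z l)) \<le> min (real L) (1 / \<bar>sin (real h * t)\<bar>)"
      using complex_Re_le_cmod eq 1 2 by (metis min.bounded_iff order_trans)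
    also have "\<dots> \<le> real L powr e * (1 / \<bar>sin (real h * t)\<bar>) powr (1 - e)"
      using hp nz e by (intro min_le_weighted_geometric_mean) auto
    also have "\<dots> = real L powr e * 1 * \<bar>sin (real h * t)\<bar> powr - (1 - e)"
      using powr_divide[of 1 "\<bar>sin (real h * t)\<bar>" "1 - e"] unfolding powr_minus by (simp add: inverse_eq_divide)
    \<comment> \<open>Since \<open>h\<close> < \<open>L\<close>, the inserted factor
      (\<open>L\<close>/\<open>h\<close>)^(1+\<open>e\<close>) is at least 1. It supplies the weight
      that makes the sum over \<open>h\<close> converge.\<close>
    also have "\<dots> \<le> real L powr e * (real L powr (1 + e) * real h powr - (1 + e)) * \<bar>sin (real h * t)\<bar> powr - (1 - e)"
    proof (intro mult_mono mult_left_mono mult_right_mono)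
      have "real h powr (1 + e) \<le> real L powr (1 + e)"
        using hp e by (intro powr_mono2) auto
      then show "1 \<le> real L powr (1 + e) * real h powr - (1 + e)"
        using hp unfolding powr_minus by (simp add: field_simps)
    qed auto
    also have "\<dots> = (real L powr e * real L powr (1 + e)) * (real h powr - (1 + e) * \<bar>sin (real h * t)\<bar> powr - (1 - e))"
      by (simp only: mult_ac)
    also have "real L powr e * real L powr (1 + e) = real L powr (1 + 2 * e)"
      by (simp flip: powr_add add: add_ac)
    finally show ?thesis .
  qed
  have "(norm (\<Sum>k<L. z k))\<^sup>2 = real L + 2 * (\<Sum>h\<in>{1..<L}. Re (\<Sum>l<L - h. z (l + h) * cnj (z l)))"
    by (subst norm_sum_squared) (simp add: z_def)
  also have "\<dots> \<le> real L powr (1 + 2 * e) + 2 * (real L powr (1 + 2 * e) * G)"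
  proof (intro add_mono mult_left_mono)
    show "real L \<le> real L powr (1 + 2 * e)"
      using False e powr_mono[of 1 "1 + 2 * e" "real L"] by simp
    have "(\<Sum>h\<in>{1..<L}. Re (\<Sum>l<L - h. z (l + h) * cnj (z l))) \<le>
        real L powr (1 + 2 * e) * (\<Sum>h\<in>{1..<L}. real h powr - (1 + e) * \<bar>sin (real h * t)\<bar> powr - (1 - e))"
      unfolding sum_distrib_left by (rule sum_mono) (rule inner)
    also have "\<dots> \<le> real L powr (1 + 2 * e) * G"
      by (rule mult_left_mono[OF G]) simp
    finally show "(\<Sum>h\<in>{1..<L}. Re (\<Sum>l<L - h. z (l + h) * cnj (z l))) \<le> real L powr (1 + 2 * e) * G" .
  qed simp
  also have "\<dots> = real L powr (1 + 2 * e) * (1 + 2 * G)"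
    by (simp add: algebra_simps)
  also have "real L powr (1 + 2 * e) * (1 + 2 * G) = (sqrt (1 + 2 * G) * real L powr (1/2 + e))\<^sup>2"
  proof -
    have "(real L powr (1/2 + e))\<^sup>2 = real L powr (1 + 2 * e)"
      by (simp add: power2_eq_square flip: powr_add)
    then show ?thesis using G0 by (simp add: power_mult_distrib)
  qed
  finally show ?thesis unfolding z_def[symmetric]
    by (rule power2_le_imp_le) (simp add: G0)
qed auto

section \<open>Local integrability of negative powers of |sin|\<close>

text \<open>The constant 1/4 is chosen for an easy proof: up to \<pi>/3 the derivative cos is at
  least 1/2, and beyond it sin is at least 1/2 while \<open>y\<close>/4 \<le> \<pi>/8 < 1/2.\<close>

lemma abs_le_abs_sin:
  fixes y :: real
  assumes "\<bar>y\<bar> \<le> pi / 2"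
  shows "\<bar>y\<bar> / 4 \<le> \<bar>sin y\<bar>"
proof -
  have pos: "y / 4 \<le> sin y" if y: "0 \<le> y" "y \<le> pi / 2" for y :: real
  proof (cases "y \<le> pi / 3")
    case True
    have "sin 0 - 0 / 4 \<le> sin y - y / 4"
    proof (rule DERIV_nonneg_imp_nondecreasing[OF y(1)])
      fix z :: real assume z: "0 \<le> z" "z \<le> y"
      have "cos (pi / 3) \<le> cos z"
        using z True by (intro cos_monotone_0_pi_le) auto
      then have "0 \<le> cos z - 1 / 4" by (simp add: cos_60)
      moreover have "((\<lambda>z. sin z - z / 4) has_real_derivative (cos z - 1 / 4)) (at z)"
        by (auto intro!: derivative_eq_intros)
      ultimately show "\<exists>d. ((\<lambda>z. sin z - z / 4) has_real_derivative d) (at z) \<and> 0 \<le> d" by blast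
    qed
    then show ?thesis by simp
  next
    case False
    have "sin (pi / 6) \<le> sin y"
      using y False by (intro sin_monotone_2pi_le) auto
    then show ?thesis using y pi_less_4 by (simp add: sin_30)
  qed
  show ?thesis
  proof (cases "0 \<le> y")
    case True
    then show ?thesis using pos[of y] assms by linarith
  next
    case False
    then show ?thesis using pos[of "-y"] assms by simp
  qed
qed

lemma nn_integral_abs_powr_finite:
  assumes "0 < p" "p < 1" "0 \<le> c"
  shows "(\<integral>\<^sup>+y. ennreal (\<bar>y\<bar> powr - p) * indicator {-c..c} y \<partial>lborel) < \<infinity>"
proof -
  define I where "I = (\<integral>\<^sup>+y. ennreal (y powr - p) * indicator {0..c} y \<partial>lborel)"
  have "((\<lambda>y. y powr - p) has_integral (c powr (- p + 1) / (- p + 1))) {0..c}"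
    using assms by (intro has_integral_powr_from_0) auto
  then have I: "I < \<infinity>"
    unfolding I_def by (subst nn_integral_has_integral_lebesgue') auto
  have "(\<integral>\<^sup>+y. ennreal ((-y) powr - p) * indicator {-c..0} y \<partial>lborel)
      = (\<integral>\<^sup>+y. ennreal ((-(0 + (-1) * y)) powr - p) * indicator {-c..0} (0 + (-1) * y) \<partial>lborel)"
    by (subst nn_integral_real_affine[where c = "-1" and t = 0]) auto
  also have "\<dots> = I" unfolding I_def
    by (intro nn_integral_cong) (auto simp: indicator_def)
  finally have I': "(\<integral>\<^sup>+y. ennreal ((-y) powr - p) * indicator {-c..0} y \<partial>lborel) = I" .
  have "(\<integral>\<^sup>+y. ennreal (\<bar>y\<bar> powr - p) * indicator {-c..c} y \<partial>lborel)
     \<le> (\<integral>\<^sup>+y. ennreal (y powr - p) * indicator {0..c} y + ennreal ((-y) powr - p) * indicator {-c..0} y \<partial>lborel)"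
    by (intro nn_integral_mono) (auto simp: indicator_def)
  also have "\<dots> = I + I"
    by (subst nn_integral_add) (auto simp: I_def[symmetric] I')
  finally show ?thesis using I by (simp add: order_le_less_trans)
qed

lemma nn_integral_abs_sin_powr_finite:
  assumes "0 < p" "p < 1"
  shows "(\<integral>\<^sup>+y. ennreal (\<bar>sin y\<bar> powr - p) * indicator {- (pi/2)..pi/2} y \<partial>lborel) < \<infinity>"
proof -
  have le: "\<bar>sin y\<bar> powr - p \<le> 4 powr p * \<bar>y\<bar> powr - p" if "\<bar>y\<bar> \<le> pi / 2" for y :: real
  proof (cases "y = 0")
    case False
    have "\<bar>sin y\<bar> powr - p \<le> (\<bar>y\<bar> / 4) powr - p"
      using False assms abs_le_abs_sin[OF that] by (intro powr_mono2') auto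
    also have "\<dots> = \<bar>y\<bar> powr - p / 4 powr - p"
      by (rule powr_divide)
    also have "\<dots> = 4 powr p * \<bar>y\<bar> powr - p"
      unfolding powr_minus[of 4 p] by (simp add: divide_inverse mult.commute)
    finally show ?thesis .
  qed auto
  have "(\<integral>\<^sup>+y. ennreal (\<bar>sin y\<bar> powr - p) * indicator {- (pi/2)..pi/2} y \<partial>lborel)
     \<le> (\<integral>\<^sup>+y. ennreal (4 powr p) * (ennreal (\<bar>y\<bar> powr - p) * indicator {- (pi/2)..pi/2} y) \<partial>lborel)"
    using le by (intro nn_integral_mono) (auto simp: indicator_def simp flip: ennreal_mult' intro!: ennreal_leI)
  also have "\<dots> = ennreal (4 powr p) * (\<integral>\<^sup>+y. ennreal (\<bar>y\<bar> powr - p) * indicator {- (pi/2)..pi/2} y \<partial>lborel)"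
    by (rule nn_integral_cmult) auto
  also have "\<dots> < \<infinity>"
    using nn_integral_abs_powr_finite[OF assms, of "pi/2"] by (simp add: ennreal_mult_less_top)
  finally show ?thesis .
qed

text \<open>The bound is uniform in the frequency \<open>h\<close> because \<open>\<bar>sin\<bar>\<close> is \<open>\<pi>\<close>-periodic.\<close>

lemma nn_integral_abs_sin_powr_scaled:
  assumes "0 < p" "p < 1"
  obtains B :: real where "0 \<le> B" and
    "\<And>h. 0 < h \<Longrightarrow> (\<integral>\<^sup>+t. ennreal (\<bar>sin (real h * t)\<bar> powr - p) * indicator {- (real K * pi)..real K * pi} t \<partial>lborel) \<le> ennreal B"
proof -
  define F where "F y = ennreal (\<bar>sin y\<bar> powr - p)" for y :: real
  have [measurable]: "F \<in> borel_measurable borel" unfolding F_def by measurable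
  define I where "I = (\<integral>\<^sup>+y. F y * indicator {- (pi/2)..pi/2} y \<partial>lborel)"
  have "I < \<infinity>" unfolding I_def F_def by (rule nn_integral_abs_sin_powr_finite[OF assms])
  then obtain c where c: "I = ennreal c" "0 \<le> c" by (cases I) auto
  have shift: "(\<integral>\<^sup>+y. F y * indicator {real_of_int k * pi - pi/2..real_of_int k * pi + pi/2} y \<partial>lborel) = I" for k
  proof -
    have abs_sin: "\<bar>sin (real_of_int k * pi + y)\<bar> = \<bar>sin y\<bar>" for y
    proof -
      have s0: "sin (real_of_int k * pi) = 0" by (simp add: sin_zero_iff_int2)
      then have "(cos (real_of_int k * pi))\<^sup>2 = 1" by (simp add: cos_squared_eq)
      then have "\<bar>cos (real_of_int k * pi)\<bar> = 1" by (simp only: power2_eq_1_iff) auto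
      then show ?thesis by (simp add: sin_add s0 abs_mult)
    qed
    show ?thesis
      unfolding I_def
      by (subst nn_integral_real_affine[where c = 1 and t = "real_of_int k * pi"])
         (auto simp: F_def abs_sin indicator_def intro!: nn_integral_cong)
  qed
  \<comment> \<open>The window containing \<open>y\<close> is the one centred at the multiple of
    \<pi> nearest to \<open>y\<close>.\<close>
  have cover: "indicator {- (real n * pi)..real n * pi} y
     \<le> (\<Sum>k=-int n..int n. indicator {real_of_int k * pi - pi/2..real_of_int k * pi + pi/2} y :: ennreal)" for n y
  proof (cases "y \<in> {- (real n * pi)..real n * pi}")
    case True
    define k where "k = round (y / pi)"
    have "\<bar>real_of_int k - y / pi\<bar> \<le> 1/2" unfolding k_def by (rule of_int_round_abs_le)
    then have k1: "\<bar>real_of_int k * pi - y\<bar> \<le> pi / 2"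
      by (simp add: field_simps abs_le_iff)
    have "- real n \<le> y / pi" "y / pi \<le> real n" using True by (auto simp: field_simps)
    then have k2: "k \<in> {-int n..int n}"
      unfolding k_def using round_mono[of "y / pi" "of_int (int n)"] round_mono[of "of_int (- int n)" "y / pi"]
      unfolding round_of_int by simp
    have "(1::ennreal) = indicator {real_of_int k * pi - pi/2..real_of_int k * pi + pi/2} y"
      using abs_le_D1[OF k1] abs_le_D2[OF k1] by (simp add: indicator_def)
    also have "\<dots> \<le> (\<Sum>k=-int n..int n. indicator {real_of_int k * pi - pi/2..real_of_int k * pi + pi/2} y)"
      using k2 by (intro member_le_sum) auto
    finally show ?thesis using True by simp
  qed auto
  have main: "(\<integral>\<^sup>+t. ennreal (\<bar>sin (real h * t)\<bar> powr - p) * indicator {- (real K * pi)..real K * pi} t \<partial>lborel)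
     \<le> ennreal (real (2 * K + 1) * c)" if h: "0 < h" for h
  proof -
    let ?n = "h * K"
    have ind: "indicator {- (real ?n * pi)..real ?n * pi} (0 + real h * t)
        = (indicator {- (real K * pi)..real K * pi} t :: ennreal)" for t
    proof -
      have "0 + real h * t \<le> real ?n * pi \<longleftrightarrow> t \<le> real K * pi"
        using h mult_le_cancel_left_pos[of "real h" t "real K * pi"] by (simp add: mult.assoc)
      moreover have "- (real ?n * pi) \<le> 0 + real h * t \<longleftrightarrow> - (real K * pi) \<le> t"
        using h mult_le_cancel_left_pos[of "real h" "- (real K * pi)" t] by (simp add: mult.assoc)
      ultimately show ?thesis by (simp only: indicator_def atLeastAtMost_iff)
    qed
    have "(\<integral>\<^sup>+y. F y * indicator {- (real ?n * pi)..real ?n * pi} y \<partial>lborel)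
       \<le> (\<integral>\<^sup>+y. (\<Sum>k=-int ?n..int ?n. F y * indicator {real_of_int k * pi - pi/2..real_of_int k * pi + pi/2} y) \<partial>lborel)"
      unfolding sum_distrib_left[symmetric] by (intro nn_integral_mono mult_left_mono cover) auto
    also have "\<dots> = (\<Sum>k=-int ?n..int ?n. I)"
      by (subst nn_integral_sum) (auto simp only: shift, measurable)
    also have "\<dots> = ennreal (real (2 * ?n + 1) * c)"
      using c by (simp add: ennreal_mult' nat_add_distrib nat_mult_distrib algebra_simps flip: ennreal_of_nat_eq_real_of_nat)
    finally have "(\<integral>\<^sup>+y. F y * indicator {- (real ?n * pi)..real ?n * pi} y \<partial>lborel) \<le> ennreal (real (2 * ?n + 1) * c)" .
    also have "(\<integral>\<^sup>+y. F y * indicator {- (real ?n * pi)..real ?n * pi} y \<partial>lborel)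
        = ennreal (real h) * (\<integral>\<^sup>+t. ennreal (\<bar>sin (real h * t)\<bar> powr - p) * indicator {- (real K * pi)..real K * pi} t \<partial>lborel)"
      using h
      by (subst nn_integral_real_affine[where c = "real h" and t = 0])
         (simp_all only: ind, simp_all add: F_def)
    finally have le: "ennreal (real h) * (\<integral>\<^sup>+t. ennreal (\<bar>sin (real h * t)\<bar> powr - p) * indicator {- (real K * pi)..real K * pi} t \<partial>lborel)
        \<le> ennreal (real (2 * ?n + 1) * c)" .
    also have "\<dots> \<le> ennreal (real h * (real (2 * K + 1) * c))"
    proof (intro ennreal_leI)
      have "real (2 * ?n + 1) \<le> real h * real (2 * K + 1)"
        using h by (simp add: algebra_simps)
      from mult_right_mono[OF this c(2)] show "real (2 * ?n + 1) * c \<le> real h * (real (2 * K + 1) * c)"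
        by (simp only: mult.assoc)
    qed
    also have "\<dots> = ennreal (real h) * ennreal (real (2 * K + 1) * c)"
      by (rule ennreal_mult') simp
    finally show ?thesis
      using h by (subst (asm) ennreal_mult_le_mult_iff) auto
  qed
  show ?thesis
    by (rule that[of "real (2 * K + 1) * c"]) (use main c in auto)
qed

text \<open>One constant for all starting points, lengths and linear phases: the same
  \<open>K\<close> then serves every cell of every shell and every point of the torus. Only the
  dependence on \<open>t\<close> and \<open>e\<close> remains.\<close>

definition weyl_bound :: "real \<Rightarrow> real \<Rightarrow> real \<Rightarrow> bool" where
  "weyl_bound t e K \<longleftrightarrow> (\<forall>(M::int) L x.
     norm (\<Sum>k<L. cis (t * (of_int (M + int k))\<^sup>2 + x * of_int (M + int k))) \<le> K * real L powr (1/2 + e))"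

lemma AE_weyl_bound:
  assumes e: "0 < e" "e < 1"
  shows "AE t in lborel. \<exists>K. weyl_bound t e K"
proof -
  \<comment> \<open>Taken in the extended nonnegative reals, the series always has a value, and
    finiteness almost everywhere can be read off from its integral. The shift by \<open>Suc\<close>
    starts the sum at h = 1.\<close>
  define G where "G t = (\<Sum>h. ennreal (real (Suc h) powr - (1 + e)) * ennreal (\<bar>sin (real (Suc h) * t)\<bar> powr - (1 - e)))" for t
  have [measurable]: "G \<in> borel_measurable borel" unfolding G_def by measurable
  \<comment> \<open>The integral of \<open>G\<close> is controlled only on bounded intervals; the
    line is exhausted by countably many of them afterwards.\<close>
  have loc: "AE t in lborel. t \<in> {- (real K * pi)..real K * pi} \<longrightarrow> G t \<noteq> \<infinity>" for K
  proof -
    obtain B where B: "0 \<le> B" "\<And>h. 0 < h \<Longrightarrow>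
      (\<integral>\<^sup>+t. ennreal (\<bar>sin (real h * t)\<bar> powr - (1 - e)) * indicator {- (real K * pi)..real K * pi} t \<partial>lborel) \<le> ennreal B"
      using nn_integral_abs_sin_powr_scaled[of "1 - e" K] e by auto
    have "summable (\<lambda>h. real h powr - (1 + e))"
      using e by (subst summable_real_powr_iff) auto
    then have "summable (\<lambda>h. real (Suc h) powr - (1 + e) * B)"
      by (intro summable_mult2) (rule summable_Suc_iff[THEN iffD2])
    then have fin: "(\<Sum>h. ennreal (real (Suc h) powr - (1 + e) * B)) < \<infinity>"
      using B by (subst suminf_ennreal2) auto
    have "(\<integral>\<^sup>+t. G t * indicator {- (real K * pi)..real K * pi} t \<partial>lborel)
      = (\<integral>\<^sup>+t. (\<Sum>h. ennreal (real (Suc h) powr - (1 + e)) *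
          (ennreal (\<bar>sin (real (Suc h) * t)\<bar> powr - (1 - e)) * indicator {- (real K * pi)..real K * pi} t)) \<partial>lborel)"
      unfolding G_def by (subst ennreal_suminf_multc[symmetric]) (simp only: mult.assoc)
    also have "\<dots> = (\<Sum>h. \<integral>\<^sup>+t. ennreal (real (Suc h) powr - (1 + e)) *
          (ennreal (\<bar>sin (real (Suc h) * t)\<bar> powr - (1 - e)) * indicator {- (real K * pi)..real K * pi} t) \<partial>lborel)"
      by (rule nn_integral_suminf) measurable
    also have "\<dots> = (\<Sum>h. ennreal (real (Suc h) powr - (1 + e)) *
          (\<integral>\<^sup>+t. ennreal (\<bar>sin (real (Suc h) * t)\<bar> powr - (1 - e)) * indicator {- (real K * pi)..real K * pi} t \<partial>lborel))"
      by (subst nn_integral_cmult) auto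
    also have "\<dots> \<le> (\<Sum>h. ennreal (real (Suc h) powr - (1 + e) * B))"
    proof (intro suminf_le)
      fix h
      show "ennreal (real (Suc h) powr - (1 + e)) *
          (\<integral>\<^sup>+t. ennreal (\<bar>sin (real (Suc h) * t)\<bar> powr - (1 - e)) * indicator {- (real K * pi)..real K * pi} t \<partial>lborel)
          \<le> ennreal (real (Suc h) powr - (1 + e) * B)"
      proof (subst ennreal_mult')
        show "ennreal (real (Suc h) powr - (1 + e)) *
          (\<integral>\<^sup>+t. ennreal (\<bar>sin (real (Suc h) * t)\<bar> powr - (1 - e)) * indicator {- (real K * pi)..real K * pi} t \<partial>lborel)
          \<le> ennreal (real (Suc h) powr - (1 + e)) * ennreal B"
          by (intro mult_left_mono B(2)) auto
      qed simp
    qed auto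
    also note fin
    finally have "(\<integral>\<^sup>+t. G t * indicator {- (real K * pi)..real K * pi} t \<partial>lborel) \<noteq> \<infinity>" by simp
    then have "AE t in lborel. G t * indicator {- (real K * pi)..real K * pi} t \<noteq> \<infinity>"
      by (intro nn_integral_PInf_AE) auto
    then show ?thesis by eventually_elim (auto simp: indicator_def)
  qed
  have "AE t in lborel. \<forall>K. t \<in> {- (real K * pi)..real K * pi} \<longrightarrow> G t \<noteq> \<infinity>"
    by (subst AE_all_countable) (use loc in auto)
  \<comment> \<open>Finiteness of \<open>G\<close> does not detect the zeros of sin, because
    \<open>powr\<close> with base 0 has value 0. The rational multiples of \<pi> are therefore
    removed separately, as a countable set.\<close>
  moreover have "AE t in lborel. \<forall>h>0. sin (real h * t) \<noteq> 0"
  proof -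
    have "{t. \<exists>h>0. sin (real h * t) = 0} \<subseteq> range (\<lambda>(h::nat, i::int). of_int i * pi / real h)"
    proof
      fix t assume "t \<in> {t. \<exists>h>0. sin (real h * t) = 0}"
      then obtain h where h: "0 < h" "sin (real h * t) = 0" by auto
      then obtain i :: int where "real h * t = of_int i * pi" by (auto simp: sin_zero_iff_int2)
      then have "t = of_int i * pi / real h" using h by (simp add: field_simps)
      then show "t \<in> range (\<lambda>(h::nat, i::int). of_int i * pi / real h)"
        by (intro image_eqI[of _ _ "(h, i)"]) auto
    qed
    then have "countable {t. \<exists>h>0. sin (real h * t) = 0}"
      by (rule countable_subset) auto
    then have "{t. \<exists>h>0. sin (real h * t) = 0} \<in> null_sets lborel"
      by (rule countable_imp_null_set_lborel)
    from AE_not_in[OF this] show ?thesis by eventually_elim blast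
  qed
  ultimately show ?thesis
  proof eventually_elim
    case (elim t)
    obtain K where K: "\<bar>t\<bar> / pi \<le> real K" using real_arch_simple by blast
    then have "t \<in> {- (real K * pi)..real K * pi}" by (auto simp: field_simps abs_le_iff)
    with elim have "G t \<noteq> \<infinity>" by blast
    then obtain g where g: "G t = ennreal g" "0 \<le> g" by (cases "G t") auto
    have "(\<Sum>h\<in>{1..<L}. real h powr - (1 + e) * \<bar>sin (real h * t)\<bar> powr - (1 - e)) \<le> g" for L
    proof -
      have "(\<Sum>h\<in>{1..<L}. real h powr - (1 + e) * \<bar>sin (real h * t)\<bar> powr - (1 - e))
          = (\<Sum>h<L - 1. real (Suc h) powr - (1 + e) * \<bar>sin (real (Suc h) * t)\<bar> powr - (1 - e))"
        by (rule sum.reindex_bij_witness[of _ Suc "\<lambda>h. h - 1"]) auto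
      also have "ennreal \<dots> = (\<Sum>h<L - 1. ennreal (real (Suc h) powr - (1 + e)) * ennreal (\<bar>sin (real (Suc h) * t)\<bar> powr - (1 - e)))"
        by (subst sum_ennreal[symmetric]) (auto simp: ennreal_mult')
      also have "\<dots> \<le> G t" unfolding G_def by (rule sum_le_suminf) auto
      finally show ?thesis using g by (simp add: ennreal_le_iff)
    qed
    then have "norm (\<Sum>k<L. cis (t * (of_int (M + int k))\<^sup>2 + x * of_int (M + int k)))
        \<le> sqrt (1 + 2 * g) * real L powr (1/2 + e)" for M L x
      using elim e by (intro quadratic_exponential_sum_le) auto
    then show ?case unfolding weyl_bound_def by blast
  qed
qed

lemma weyl_bound_pos:
  assumes "weyl_bound t e K"
  shows "1 \<le> K"
proof -
  have "norm (\<Sum>k<1. cis (t * (of_int (0 + int k))\<^sup>2 + 0 * of_int (0 + int k))) \<le> K * real 1 powr (1/2 + e)"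
    using assms unfolding weyl_bound_def by blast
  then show ?thesis by simp
qed

lemma weyl_bound_mono:
  assumes "weyl_bound t e K" "e \<le> e'"
  shows "weyl_bound t e' K"
  unfolding weyl_bound_def
proof (intro allI)
  fix M :: int and L :: nat and x :: real
  have "norm (\<Sum>k<L. cis (t * (of_int (M + int k))\<^sup>2 + x * of_int (M + int k))) \<le> K * real L powr (1/2 + e)"
    using assms(1) by (simp add: weyl_bound_def)
  also have "\<dots> \<le> K * real L powr (1/2 + e')"
    using weyl_bound_pos[OF assms(1)] assms(2)
    by (cases "L = 0") (auto intro!: mult_left_mono powr_mono)
  finally show "norm (\<Sum>k<L. cis (t * (of_int (M + int k))\<^sup>2 + x * of_int (M + int k))) \<le> K * real L powr (1/2 + e')" .
qed

text \<open>The bounds weaken as \<open>e\<close> grows, so a sequence of exponents tending to 0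
  suffices and only countably many null sets are discarded. The form 1/(n+2) keeps every exponent
  strictly below 1.\<close>

lemma AE_weyl_bound_all: "AE t in lborel. \<forall>e>0. \<exists>K. weyl_bound t e K"
proof -
  have "AE t in lborel. \<forall>n. \<exists>K. weyl_bound t (1 / real (n + 2)) K"
    unfolding AE_all_countable by (intro allI AE_weyl_bound) auto
  then show ?thesis
  proof eventually_elim
    case (elim t)
    show ?case
    proof (intro allI impI)
      fix e :: real assume "0 < e"
      then obtain n where "1 / real (Suc n) < e" using nat_approx_posE by blast
      moreover have "1 / real (n + 2) \<le> 1 / real (Suc n)" by (simp add: frac_le)
      ultimately show "\<exists>K. weyl_bound t e K" using elim[rule_format, of n] weyl_bound_mono by (meson less_imp_le order_trans)
    qed
  qed
qed

section \<open>Summation by parts and dyadic shells\<close>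

text \<open>Abel summation: the boundary term costs \<open>A\<close> \<open>P\<close>, and each
  increment of \<open>a\<close> costs \<open>B\<close> \<open>P\<close>. Requiring \<open>P\<close>
  for all initial segments is what lets cancellation in \<open>e\<close> survive multiplication by a
  slowly varying \<open>a\<close>.\<close>

lemma norm_abel_sum_le:
  fixes a e :: "nat \<Rightarrow> complex"
  assumes P: "\<And>n. n \<le> L \<Longrightarrow> norm (\<Sum>k<n. e k) \<le> P"
    and A: "\<And>k. k < L \<Longrightarrow> norm (a k) \<le> A"
    and B: "\<And>k. Suc k < L \<Longrightarrow> norm (a (Suc k) - a k) \<le> B"
    and nonneg: "0 \<le> A" "0 \<le> B"
  shows "norm (\<Sum>k<L. a k * e k) \<le> P * (A + real L * B)"
proof (cases L)
  case 0
  then show ?thesis using P[of 0] nonneg by simp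
next
  case (Suc N)
  have P0: "0 \<le> P" using P[of 0] by simp
  have abel: "(\<Sum>k<Suc n. a k * e k) = a n * (\<Sum>k<Suc n. e k) - (\<Sum>k<n. (a (Suc k) - a k) * (\<Sum>i<Suc k. e i))" for n
    by (induction n) (simp_all add: algebra_simps)
  have "norm (\<Sum>k<L. a k * e k)
     \<le> norm (a N * (\<Sum>k<Suc N. e k)) + norm (\<Sum>k<N. (a (Suc k) - a k) * (\<Sum>i<Suc k. e i))"
    unfolding Suc abel by (rule norm_triangle_ineq4)
  also have "\<dots> \<le> A * P + (\<Sum>k<N. B * P)"
  proof (intro add_mono order_trans[OF norm_sum] sum_mono)
    show "norm (a N * (\<Sum>k<Suc N. e k)) \<le> A * P"
      unfolding norm_mult using A[of N] P[of "Suc N"] Suc nonneg by (intro mult_mono) auto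
    show "norm ((a (Suc k) - a k) * (\<Sum>i<Suc k. e i)) \<le> B * P" if "k \<in> {..<N}" for k
      unfolding norm_mult using that B[of k] P[of "Suc k"] Suc nonneg by (intro mult_mono) auto
  qed
  also have "\<dots> = P * (A + real N * B)" by (simp add: algebra_simps)
  also have "\<dots> \<le> P * (A + real L * B)"
    using Suc nonneg P0 by (intro mult_left_mono add_left_mono mult_right_mono) auto
  finally show ?thesis .
qed

text \<open>The one-variable estimate is applied in \<open>k\<close> to the rows \<open>b l\<close>
  and to their differences, whose coefficients have size \<open>B\<close> and variation
  \<open>D\<close>; a last application in \<open>l\<close> uses these two bounds as its own
  \<open>A\<close> and \<open>B\<close>.\<close>

lemma norm_abel_sum2_le:
  fixes a :: "nat \<Rightarrow> nat \<Rightarrow> complex" and e e' :: "nat \<Rightarrow> complex"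
  assumes P: "\<And>n. n \<le> L \<Longrightarrow> norm (\<Sum>k<n. e k) \<le> P"
    and P': "\<And>n. n \<le> L \<Longrightarrow> norm (\<Sum>k<n. e' k) \<le> P'"
    and A: "\<And>k l. k < L \<Longrightarrow> l < L \<Longrightarrow> norm (a k l) \<le> A"
    and B1: "\<And>k l. Suc k < L \<Longrightarrow> l < L \<Longrightarrow> norm (a (Suc k) l - a k l) \<le> B"
    and B2: "\<And>k l. k < L \<Longrightarrow> Suc l < L \<Longrightarrow> norm (a k (Suc l) - a k l) \<le> B"
    and D: "\<And>k l. Suc k < L \<Longrightarrow> Suc l < L \<Longrightarrow>
              norm (a (Suc k) (Suc l) - a (Suc k) l - a k (Suc l) + a k l) \<le> D"
    and nonneg: "0 \<le> A" "0 \<le> B" "0 \<le> D"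
  shows "norm (\<Sum>l<L. \<Sum>k<L. a k l * e k * e' l) \<le> P * P' * (A + 2 * real L * B + (real L)\<^sup>2 * D)"
proof -
  define b where "b l = (\<Sum>k<L. a k l * e k)" for l
  have P0: "0 \<le> P" using P[of 0] by simp
  have "norm (\<Sum>l<L. b l * e' l) \<le> P' * (P * (A + real L * B) + real L * (P * (B + real L * D)))"
  proof (rule norm_abel_sum_le[OF P'])
    show "norm (b l) \<le> P * (A + real L * B)" if "l < L" for l
      unfolding b_def using A B1 that nonneg by (intro norm_abel_sum_le[OF P]) auto
    show "norm (b (Suc l) - b l) \<le> P * (B + real L * D)" if l: "Suc l < L" for l
    proof -
      have "b (Suc l) - b l = (\<Sum>k<L. (a k (Suc l) - a k l) * e k)"
        by (simp add: b_def sum_subtractf algebra_simps)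
      also have "norm \<dots> \<le> P * (B + real L * D)"
      proof (rule norm_abel_sum_le[OF P])
        show "norm (a (Suc k) (Suc l) - a (Suc k) l - (a k (Suc l) - a k l)) \<le> D" if "Suc k < L" for k
          using D[OF that l] by (simp add: algebra_simps)
      qed (use B2 l nonneg in auto)
      finally show ?thesis .
    qed
  qed (use P0 nonneg in auto)
  also have "(\<Sum>l<L. b l * e' l) = (\<Sum>l<L. \<Sum>k<L. a k l * e k * e' l)"
    by (simp add: b_def sum_distrib_right)
  finally show ?thesis by (simp add: algebra_simps power2_eq_square)
qed

section \<open>Dyadic squares, shells and cells in the frequency lattice\<close>

definition dyadic_square :: "nat \<Rightarrow> (int \<times> int) set" where
  "dyadic_square j = {- (2 ^ j)..<2 ^ j} \<times> {- (2 ^ j)..<2 ^ j}"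

definition dyadic_shell :: "nat \<Rightarrow> (int \<times> int) set" where
  "dyadic_shell j = dyadic_square (Suc j) - dyadic_square j"

definition dyadic_cell :: "nat \<Rightarrow> int \<times> int \<Rightarrow> (int \<times> int) set" where
  "dyadic_cell j p = {fst p * 2 ^ j..<fst p * 2 ^ j + 2 ^ j} \<times> {snd p * 2 ^ j..<snd p * 2 ^ j + 2 ^ j}"

text \<open>Index set of the cells of side 2^j that make up the \<open>j\<close>-th shell; it does
  not depend on \<open>j\<close>. Cells, unlike the shell itself, are products of intervals, as
  summation by parts in two variables requires.\<close>

definition shell_cells :: "(int \<times> int) set" where
  "shell_cells = {-2..<2} \<times> {-2..<2} - {-1..<1} \<times> {-1..<1}"

lemma finite_dyadic_square [simp]: "finite (dyadic_square j)"
  by (simp add: dyadic_square_def)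

lemma finite_dyadic_shell [simp]: "finite (dyadic_shell j)"
  by (simp add: dyadic_shell_def)

lemma finite_shell_cells [simp]: "finite shell_cells"
  by (simp add: shell_cells_def)

lemma card_shell_cells_le: "card shell_cells \<le> 16"
  by (rule order_trans[OF card_mono[of "{-2..<2} \<times> {-2..<2}"]]) (auto simp: shell_cells_def card_cartesian_product)

lemma dyadic_square_mono: "i \<le> j \<Longrightarrow> dyadic_square i \<subseteq> dyadic_square j"
proof -
  assume "i \<le> j"
  then have "(2::int) ^ i \<le> 2 ^ j" by (simp add: power_increasing)
  then show ?thesis unfolding dyadic_square_def by (intro Sigma_mono) auto
qed

lemma dyadic_square_cover: "finite F \<Longrightarrow> \<exists>j. F \<subseteq> dyadic_square j"
proof (induction F rule: finite_induct)
  case (insert m F)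
  then obtain j where j: "F \<subseteq> dyadic_square j" by auto
  define n where "n = nat (max \<bar>fst m\<bar> \<bar>snd m\<bar>)"
  have "int n < 2 ^ n" using of_nat_less_two_power[of n, where 'a = int] by simp
  then have "m \<in> dyadic_square n"
  proof -
    have "int n = max \<bar>fst m\<bar> \<bar>snd m\<bar>" unfolding n_def by (simp add: le_max_iff_disj)
    then have "\<bar>fst m\<bar> \<le> int n" "\<bar>snd m\<bar> \<le> int n" by simp_all
    then show ?thesis
      using \<open>int n < 2 ^ n\<close> unfolding dyadic_square_def mem_Times_iff atLeastLessThan_iff by linarith
  qed
  then have "insert m F \<subseteq> dyadic_square (max j n)"
    using j dyadic_square_mono[of j "max j n"] dyadic_square_mono[of n "max j n"] by auto
  then show ?case by blast
qed auto

lemma le_int_div_iff: "a \<le> n div d \<longleftrightarrow> a * d \<le> n" if "0 < d" for a d n :: int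
proof
  assume "a \<le> n div d"
  then have "a * d \<le> n div d * d" using that by (intro mult_right_mono) auto
  also have "\<dots> \<le> n" using div_mult_mod_eq[of n d] pos_mod_sign[OF that, of n] by linarith
  finally show "a * d \<le> n" .
next
  assume "a * d \<le> n"
  from zdiv_mono1[OF this that] show "a \<le> n div d" using that by simp
qed

lemma mem_int_interval_iff_div:
  fixes a b d n :: int
  assumes "0 < d"
  shows "n \<in> {a * d..<b * d} \<longleftrightarrow> n div d \<in> {a..<b}"
  using le_int_div_iff[OF assms, of a n] le_int_div_iff[OF assms, of b n] by auto

text \<open>The cells are the fibres of componentwise floor division by 2^j; this is why all
  intervals are half-open, negative ones included. The partition of a shell into cells becomes a
  grouping of a sum by the value of a function.\<close>

lemma mem_dyadic_cell_iff: "m \<in> dyadic_cell j p \<longleftrightarrow> (fst m div 2 ^ j, snd m div 2 ^ j) = p"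
proof -
  have *: "n \<in> {q * 2 ^ j..<q * 2 ^ j + 2 ^ j} \<longleftrightarrow> n div 2 ^ j = q" for n q :: int
  proof -
    have "q * 2 ^ j + 2 ^ j = (q + 1) * 2 ^ j" by (simp add: algebra_simps)
    then show ?thesis using mem_int_interval_iff_div[of "2 ^ j" n q "q + 1"] by auto
  qed
  show ?thesis unfolding dyadic_cell_def by (simp only: mem_Times_iff * prod_eq_iff fst_conv snd_conv)
qed

lemma dyadic_square_iff_div:
  "m \<in> dyadic_square j \<longleftrightarrow> (fst m div 2 ^ j, snd m div 2 ^ j) \<in> {-1..<1} \<times> {-1..<1}"
proof -
  have *: "n \<in> {- (2 ^ j)..<2 ^ j} \<longleftrightarrow> n div 2 ^ j \<in> {-1..<1}" for n :: int
    using mem_int_interval_iff_div[of "2 ^ j" n "-1" 1] by simp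
  show ?thesis unfolding dyadic_square_def by (simp only: * mem_Times_iff fst_conv snd_conv)
qed

lemma dyadic_shell_iff_div:
  "m \<in> dyadic_shell j \<longleftrightarrow> (fst m div 2 ^ j, snd m div 2 ^ j) \<in> shell_cells"
proof -
  have *: "n \<in> {- (2 ^ Suc j)..<2 ^ Suc j} \<longleftrightarrow> n div 2 ^ j \<in> {-2..<2}" for n :: int
    using mem_int_interval_iff_div[of "2 ^ j" n "-2" 2] by simp
  have "m \<in> dyadic_square (Suc j) \<longleftrightarrow> (fst m div 2 ^ j, snd m div 2 ^ j) \<in> {-2..<2} \<times> {-2..<2}"
    unfolding dyadic_square_def by (simp only: * mem_Times_iff fst_conv snd_conv)
  then show ?thesis unfolding dyadic_shell_def shell_cells_def by (simp only: Diff_iff dyadic_square_iff_div)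
qed

lemma dyadic_cell_subset_shell: "p \<in> shell_cells \<Longrightarrow> dyadic_cell j p \<subseteq> dyadic_shell j"
  by (auto simp: mem_dyadic_cell_iff dyadic_shell_iff_div)

lemma sum_dyadic_shell:
  fixes g :: "int \<times> int \<Rightarrow> 'a::comm_monoid_add"
  shows "(\<Sum>m\<in>dyadic_shell j. g m) = (\<Sum>p\<in>shell_cells. \<Sum>m\<in>dyadic_cell j p. g m)"
proof -
  have "(\<Sum>p\<in>shell_cells. \<Sum>m | m \<in> dyadic_shell j \<and> (fst m div 2 ^ j, snd m div 2 ^ j) = p. g m)
      = (\<Sum>m\<in>dyadic_shell j. g m)"
    by (rule sum.group) (auto simp: dyadic_shell_iff_div)
  moreover have "{m. m \<in> dyadic_shell j \<and> (fst m div 2 ^ j, snd m div 2 ^ j) = p} = dyadic_cell j p"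
    if "p \<in> shell_cells" for p
    using that by (auto simp: mem_dyadic_cell_iff dyadic_shell_iff_div)
  ultimately show ?thesis by simp
qed

lemma sum_dyadic_cell:
  fixes g :: "int \<times> int \<Rightarrow> 'a::comm_monoid_add"
  shows "(\<Sum>m\<in>dyadic_cell j p. g m)
    = (\<Sum>l<2 ^ j. \<Sum>k<2 ^ j. g (fst p * 2 ^ j + int k, snd p * 2 ^ j + int l))"
proof -
  have "(\<Sum>l<2 ^ j. \<Sum>k<2 ^ j. g (fst p * 2 ^ j + int k, snd p * 2 ^ j + int l))
     = (\<Sum>(l, k)\<in>{..<2 ^ j} \<times> {..<2 ^ j}. g (fst p * 2 ^ j + int k, snd p * 2 ^ j + int l))"
    by (rule sum.cartesian_product)
  also have "\<dots> = (\<Sum>m\<in>dyadic_cell j p. g m)"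
  proof (rule sum.reindex_bij_witness[of _ "\<lambda>m. (nat (snd m - snd p * 2 ^ j), nat (fst m - fst p * 2 ^ j))"
         "\<lambda>(l, k). (fst p * 2 ^ j + int k, snd p * 2 ^ j + int l)"])
    have *: "int k < 2 ^ j \<longleftrightarrow> k < 2 ^ j" for k
      using of_nat_less_iff[of k "2 ^ j", where 'a = int] by simp
    show "(case a of (l, k) \<Rightarrow> (fst p * 2 ^ j + int k, snd p * 2 ^ j + int l)) \<in> dyadic_cell j p"
      if "a \<in> {..<2 ^ j} \<times> {..<2 ^ j}" for a
      using that by (cases a) (simp add: dyadic_cell_def *)
    show "(nat (snd m - snd p * 2 ^ j), nat (fst m - fst p * 2 ^ j)) \<in> {..<2 ^ j} \<times> {..<2 ^ j}"
      if "m \<in> dyadic_cell j p" for m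
      using that by (cases m) (simp add: dyadic_cell_def flip: *)
    show "(case (nat (snd m - snd p * 2 ^ j), nat (fst m - fst p * 2 ^ j)) of
          (l, k) \<Rightarrow> (fst p * 2 ^ j + int k, snd p * 2 ^ j + int l)) = m"
      if "m \<in> dyadic_cell j p" for m
      using that by (cases m) (simp add: dyadic_cell_def)
  qed (auto split: prod.splits)
  finally show ?thesis by simp
qed

lemma card_dyadic_shell_le: "card (dyadic_shell j) \<le> 16 * 4 ^ j"
proof -
  have "card (dyadic_shell j) \<le> card (dyadic_square (Suc j))"
    by (rule card_mono) (auto simp: dyadic_shell_def)
  also have "\<dots> = 16 * 4 ^ j"
  proof -
    have "card {- (2 ^ Suc j)..<2 ^ Suc j :: int} = 4 * 2 ^ j"
      using nat_power_eq[of 2 j] by (simp add: nat_mult_distrib)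
    moreover have "(2::nat) ^ j * 2 ^ j = 4 ^ j" by (simp flip: power_mult_distrib)
    ultimately show ?thesis unfolding dyadic_square_def card_cartesian_product by (simp add: algebra_simps)
  qed
  finally show ?thesis .
qed

lemma dyadic_shell_component:
  assumes "m \<in> dyadic_shell j"
  shows "\<bar>fst m\<bar> \<le> 2 ^ Suc j" "\<bar>snd m\<bar> \<le> 2 ^ Suc j" "2 ^ j \<le> \<bar>fst m\<bar> \<or> 2 ^ j \<le> \<bar>snd m\<bar>"
proof -
  have "m \<in> dyadic_square (Suc j)" and not: "m \<notin> dyadic_square j"
    using assms unfolding dyadic_shell_def by blast+
  then have "- (2 ^ Suc j) \<le> fst m \<and> fst m < 2 ^ Suc j" "- (2 ^ Suc j) \<le> snd m \<and> snd m < 2 ^ Suc j"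
    unfolding dyadic_square_def mem_Times_iff atLeastLessThan_iff by blast+
  then show "\<bar>fst m\<bar> \<le> 2 ^ Suc j" "\<bar>snd m\<bar> \<le> 2 ^ Suc j" by linarith+
  have "\<not> (- (2 ^ j) \<le> fst m \<and> fst m < 2 ^ j) \<or> \<not> (- (2 ^ j) \<le> snd m \<and> snd m < 2 ^ j)"
    using not unfolding dyadic_square_def mem_Times_iff atLeastLessThan_iff by blast
  then show "2 ^ j \<le> \<bar>fst m\<bar> \<or> 2 ^ j \<le> \<bar>snd m\<bar>" by linarith
qed

lemma bracket_ge_1: "1 \<le> bracket m"
  by (simp add: bracket_def normsq_def)

lemma bracket_pos: "0 < bracket m"
  using bracket_ge_1[of m] by linarith

lemma bracket_dyadic_shell:
  assumes "m \<in> dyadic_shell j"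
  shows "2 ^ j \<le> bracket m" "bracket m \<le> 4 * 2 ^ j"
proof -
  note c = dyadic_shell_component[OF assms]
  have sq: "(2 ^ j)\<^sup>2 \<le> (real_of_int n)\<^sup>2" if "2 ^ j \<le> \<bar>n\<bar>" for n
  proof -
    have "2 ^ j \<le> \<bar>real_of_int n\<bar>" using that by (metis of_int_abs of_int_le_iff of_int_numeral of_int_power)
    then have "(2 ^ j)\<^sup>2 \<le> \<bar>real_of_int n\<bar>\<^sup>2" by (rule power_mono) simp
    then show ?thesis by simp
  qed
  have "(2 ^ j)\<^sup>2 \<le> 1 + normsq m"
    using c(3) sq[of "fst m"] sq[of "snd m"] unfolding normsq_def
    by (smt (verit) zero_le_power2)
  then show "2 ^ j \<le> bracket m" unfolding bracket_def by (rule real_le_rsqrt)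
  have sq': "(real_of_int n)\<^sup>2 \<le> 4 * (2 ^ j)\<^sup>2" if "\<bar>n\<bar> \<le> 2 ^ Suc j" for n
  proof -
    have "\<bar>real_of_int n\<bar> \<le> 2 ^ Suc j" using that by (metis of_int_abs of_int_le_iff of_int_numeral of_int_power)
    then have "\<bar>real_of_int n\<bar>\<^sup>2 \<le> (2 ^ Suc j)\<^sup>2" by (rule power_mono) simp
    then show ?thesis by (simp add: power_mult_distrib)
  qed
  have "(1::real) \<le> (2 ^ j)\<^sup>2" by (simp add: one_le_power)
  then have "1 + normsq m \<le> 16 * (2 ^ j)\<^sup>2"
    using sq'[OF c(1)] sq'[OF c(2)] unfolding normsq_def by linarith
  also have "16 * (2 ^ j)\<^sup>2 = (4 * 2 ^ j :: real)\<^sup>2" by (simp add: power_mult_distrib)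
  finally show "bracket m \<le> 4 * 2 ^ j" unfolding bracket_def by (intro real_le_lsqrt) auto
qed

lemma sum_dyadic_square:
  fixes g :: "int \<times> int \<Rightarrow> 'a::comm_monoid_add"
  shows "(\<Sum>m\<in>dyadic_square (j + n). g m) = (\<Sum>m\<in>dyadic_square j. g m) + (\<Sum>i<n. \<Sum>m\<in>dyadic_shell (j + i). g m)"
proof (induction n)
  case (Suc n)
  have "(\<Sum>m\<in>dyadic_square (Suc (j + n)). g m) = (\<Sum>m\<in>dyadic_shell (j + n). g m) + (\<Sum>m\<in>dyadic_square (j + n). g m)"
    unfolding dyadic_shell_def using dyadic_square_mono[of "j + n" "Suc (j + n)"]
    by (intro sum.subset_diff) auto
  with Suc show ?case by (simp add: ac_simps)
qed auto

text \<open>Every finite set of frequencies lies in a dyadic square, so partial sums are bounded by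
  a fixed finite part and a geometric series. The threshold \<open>j0\<close> admits shell estimates
  that hold only for large \<open>j\<close>, such as those coming from an upper limit of covering
  numbers.\<close>

lemma summable_on_dyadic:
  fixes g :: "int \<times> int \<Rightarrow> real"
  assumes nonneg: "\<And>m. 0 \<le> g m"
    and B: "\<And>j. j \<ge> j0 \<Longrightarrow> (\<Sum>m\<in>dyadic_shell j. g m) \<le> B * q ^ j"
    and q: "0 \<le> q" "q < 1"
  shows "g summable_on UNIV"
proof (rule nonneg_bdd_above_summable_on)
  have sm: "summable (\<lambda>i. B * q ^ (j0 + i))"
    unfolding power_add using q by (intro summable_mult) simp
  \<comment> \<open>The sign of \<open>B\<close> is not given; it is forced by the estimate of a sum
    of nonnegative terms.\<close>
  have Bn: "0 \<le> B * q ^ (j0 + i)" for i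
    using B[of "j0 + i"] sum_nonneg[of "dyadic_shell (j0 + i)" g] nonneg by force
  have "sum g F \<le> (\<Sum>m\<in>dyadic_square j0. g m) + (\<Sum>i. B * q ^ (j0 + i))" if F: "finite F" for F
  proof -
    obtain n where n: "F \<subseteq> dyadic_square n" using dyadic_square_cover[OF F] by blast
    have "sum g F \<le> sum g (dyadic_square (j0 + n))"
      using n dyadic_square_mono[of n "j0 + n"] nonneg by (intro sum_mono2) auto
    also have "\<dots> \<le> (\<Sum>m\<in>dyadic_square j0. g m) + (\<Sum>i<n. B * q ^ (j0 + i))"
      unfolding sum_dyadic_square by (intro add_left_mono sum_mono B) auto
    also have "(\<Sum>i<n. B * q ^ (j0 + i)) \<le> (\<Sum>i. B * q ^ (j0 + i))"
      by (rule sum_le_suminf[OF sm]) (use Bn in auto)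
    finally show ?thesis by simp
  qed
  then show "bdd_above (sum g ` {F. F \<subseteq> UNIV \<and> finite F})" by (intro bdd_aboveI) auto
qed (use nonneg in auto)

section \<open>Uniform convergence and Hoelder continuity of the series\<close>

lemma norm_character [simp]: "norm (character m x) = 1"
  unfolding character_def cis_conv_exp[symmetric] by (rule norm_cis)

lemma character_eq_cis: "character m x = cis (of_int (fst m) * fst x) * cis (of_int (snd m) * snd x)"
  unfolding character_def cis_mult cis_conv_exp[symmetric] ..

text \<open>Everything from here on concerns one fixed \<open>t\<close> and an abstract coefficient
  family. The exceptional set of times enters only through \<open>weyl\<close>, and the function f
  only where \<open>a\<close> is set to its Fourier coefficients.\<close>

locale weyl_series =
  fixes a :: "int \<times> int \<Rightarrow> complex" and s C t :: real
  assumes s: "0 < s" "s < 1"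
    and a_le: "\<And>m. norm (a m) \<le> C / bracket m powr (1 + s)"
    and a1_le: "\<And>m1 m2. norm (a (m1 + 1, m2) - a (m1, m2)) \<le> C / bracket (m1, m2) powr (2 + s)"
    and a2_le: "\<And>m1 m2. norm (a (m1, m2 + 1) - a (m1, m2)) \<le> C / bracket (m1, m2) powr (2 + s)"
    and a12_le: "\<And>m1 m2. norm (a (m1 + 1, m2 + 1) - a (m1 + 1, m2) - a (m1, m2 + 1) + a (m1, m2))
        \<le> C / bracket (m1, m2) powr (3 + s)"
    and weyl: "\<And>e. 0 < e \<Longrightarrow> \<exists>K. weyl_bound t e K"
begin

lemma C_nonneg: "0 \<le> C"
  using order_trans[OF norm_ge_zero a_le[of "(0, 0)"]] by (simp add: bracket_def normsq_def)

definition coeff :: "int \<times> int \<Rightarrow> complex" where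
  "coeff m = exp (\<i> * complex_of_real (normsq m * t)) * a m"

definition partial_sum :: "nat \<Rightarrow> real \<times> real \<Rightarrow> complex" where
  "partial_sum j x = (\<Sum>m\<in>dyadic_square j. coeff m * character m x)"

definition shell_sum :: "nat \<Rightarrow> real \<times> real \<Rightarrow> complex" where
  "shell_sum j x = (\<Sum>m\<in>dyadic_shell j. coeff m * character m x)"

text \<open>The exponent |m|^2 t + m . x splits into one-variable phases, so each term of the series
  is a coefficient times two waves.\<close>

definition wave :: "real \<Rightarrow> int \<Rightarrow> complex" where
  "wave y n = cis (t * (of_int n)\<^sup>2 + y * of_int n)"

lemma shell_sum_eq_wave:
  "shell_sum j x = (\<Sum>m\<in>dyadic_shell j. a m * wave (fst x) (fst m) * wave (snd x) (snd m))"
  unfolding shell_sum_def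
proof (rule sum.cong[OF refl])
  fix m :: "int \<times> int"
  have "exp (\<i> * complex_of_real (normsq m * t)) * character m x = wave (fst x) (fst m) * wave (snd x) (snd m)"
    unfolding character_eq_cis wave_def cis_conv_exp[symmetric] cis_mult normsq_def
    by (simp add: algebra_simps)
  then show "coeff m * character m x = a m * wave (fst x) (fst m) * wave (snd x) (snd m)"
    unfolding coeff_def by (simp add: algebra_simps)
qed

text \<open>Each difference of \<open>a\<close> gains a factor 2^(-j), which pays for the factor 2^j
  that summation by parts attaches to it; all contributions have the same order. The factors
  \<open>e1\<close> and \<open>e2\<close> are left general so that differences of waves can be
  inserted for Lipschitz bounds.\<close>

lemma norm_shell_sum_le:
  fixes e1 e2 :: "int \<Rightarrow> complex"
  assumes P: "\<And>p n. -2 \<le> p \<Longrightarrow> p < 2 \<Longrightarrow> n \<le> 2 ^ j \<Longrightarrow> norm (\<Sum>k<n. e1 (p * 2 ^ j + int k)) \<le> P"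
    and P': "\<And>p n. -2 \<le> p \<Longrightarrow> p < 2 \<Longrightarrow> n \<le> 2 ^ j \<Longrightarrow> norm (\<Sum>k<n. e2 (p * 2 ^ j + int k)) \<le> P'"
  shows "norm (\<Sum>m\<in>dyadic_shell j. a m * e1 (fst m) * e2 (snd m)) \<le> 64 * C * P * P' / (2 ^ j) powr (1 + s)"
proof -
  define L where "L = (2 ^ j :: real)"
  have L: "0 < L" by (simp add: L_def)
  have P0: "0 \<le> P" using P[of 0 0] by simp
  have P'0: "0 \<le> P'" using P'[of 0 0] by simp
  have decay: "C / bracket m powr q \<le> C / L powr q" if "m \<in> dyadic_shell j" "0 \<le> q" for m q
    using bracket_dyadic_shell(1)[OF that(1)] that(2) L C_nonneg
    using bracket_pos[of m] by (intro divide_left_mono powr_mono2 mult_pos_pos) (auto simp: L_def)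
  have cell: "norm (\<Sum>m\<in>dyadic_cell j p. a m * e1 (fst m) * e2 (snd m)) \<le> P * P' * (4 * C / L powr (1 + s))"
    if p: "p \<in> shell_cells" for p
  proof -
    have p': "-2 \<le> fst p" "fst p < 2" "-2 \<le> snd p" "snd p < 2"
      using p by (auto simp: shell_cells_def)
    let ?M = "fst p * 2 ^ j" and ?N = "snd p * 2 ^ j"
    have mem: "(?M + int k, ?N + int l) \<in> dyadic_shell j" if "k < 2 ^ j" "l < 2 ^ j" for k l
    proof -
      have "int k < 2 ^ j" "int l < 2 ^ j" using that by (metis of_nat_less_iff of_nat_numeral of_nat_power)+
      then have "(?M + int k, ?N + int l) \<in> dyadic_cell j p" by (simp add: dyadic_cell_def)
      then show ?thesis using dyadic_cell_subset_shell[OF p] by blast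
    qed
    have Suc_eq: "N + int (Suc k) = N + int k + 1" for N k by simp
    have "norm (\<Sum>l<2 ^ j. \<Sum>k<2 ^ j. a (?M + int k, ?N + int l) * e1 (?M + int k) * e2 (?N + int l))
      \<le> P * P' * (C / L powr (1 + s) + 2 * real (2 ^ j) * (C / L powr (2 + s)) + (real (2 ^ j))\<^sup>2 * (C / L powr (3 + s)))"
    proof (rule norm_abel_sum2_le)
      show "norm (a (?M + int k, ?N + int l)) \<le> C / L powr (1 + s)" if "k < 2 ^ j" "l < 2 ^ j" for k l
        using order_trans[OF a_le decay[OF mem[OF that]]] s by simp
      show "norm (a (?M + int (Suc k), ?N + int l) - a (?M + int k, ?N + int l)) \<le> C / L powr (2 + s)"
        if "Suc k < 2 ^ j" "l < 2 ^ j" for k l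
        using order_trans[OF a1_le decay[OF mem]] that s unfolding Suc_eq by simp
      show "norm (a (?M + int k, ?N + int (Suc l)) - a (?M + int k, ?N + int l)) \<le> C / L powr (2 + s)"
        if "k < 2 ^ j" "Suc l < 2 ^ j" for k l
        using order_trans[OF a2_le decay[OF mem]] that s unfolding Suc_eq by simp
      show "norm (a (?M + int (Suc k), ?N + int (Suc l)) - a (?M + int (Suc k), ?N + int l)
          - a (?M + int k, ?N + int (Suc l)) + a (?M + int k, ?N + int l)) \<le> C / L powr (3 + s)"
        if "Suc k < 2 ^ j" "Suc l < 2 ^ j" for k l
        using order_trans[OF a12_le decay[OF mem]] that s unfolding Suc_eq by simp
    qed (use P P' p' C_nonneg in auto)
    also have "real (2 ^ j) = L" by (simp add: L_def)
    also have "L powr (2 + s) = L * L powr (1 + s)"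
      using L powr_add[of L 1 "1 + s"] by simp
    also have "L powr (3 + s) = L\<^sup>2 * L powr (1 + s)"
      using L powr_add[of L 2 "1 + s"] by simp
    \<comment> \<open>The weights 1 + 2 + 1 give the 4. With at most 16 cells this is the constant
      64.\<close>
    also have "C / L powr (1 + s) + 2 * L * (C / (L * L powr (1 + s))) + L\<^sup>2 * (C / (L\<^sup>2 * L powr (1 + s))) = 4 * C / L powr (1 + s)"
      using L by (simp add: field_simps)
    finally show ?thesis by (simp add: sum_dyadic_cell)
  qed
  have "norm (\<Sum>m\<in>dyadic_shell j. a m * e1 (fst m) * e2 (snd m)) \<le> (\<Sum>p\<in>shell_cells. P * P' * (4 * C / L powr (1 + s)))"
    unfolding sum_dyadic_shell by (rule order_trans[OF norm_sum sum_mono]) (rule cell)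
  also have "\<dots> = real (card shell_cells) * (P * P' * (4 * C / L powr (1 + s)))" by simp
  also have "\<dots> \<le> 16 * (P * P' * (4 * C / L powr (1 + s)))"
    using card_shell_cells_le P0 P'0 C_nonneg by (intro mult_right_mono) auto
  finally show ?thesis by (simp add: L_def algebra_simps)
qed

lemma norm_sum_wave_le:
  assumes K: "weyl_bound t e K" and "0 \<le> e" "n \<le> 2 ^ j"
  shows "norm (\<Sum>k<n. wave y (M + int k)) \<le> K * (2 ^ j) powr (1/2 + e)"
proof -
  have n: "real n \<le> 2 ^ j" using assms(3) by (metis of_nat_le_iff of_nat_numeral of_nat_power)
  have "norm (\<Sum>k<n. wave y (M + int k)) \<le> K * real n powr (1/2 + e)"
    using K unfolding weyl_bound_def wave_def by blast
  also have "\<dots> \<le> K * (2 ^ j) powr (1/2 + e)"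
    using weyl_bound_pos[OF K] assms(2) n by (intro mult_left_mono powr_mono2) auto
  finally show ?thesis .
qed

text \<open>Shifting by \<open>h\<close> multiplies the wave by cis(\<open>h\<close>m) - 1, a
  multiplier of size at most 2 . 2^j |\<open>h\<close>| with increments at most |\<open>h\<close>|.
  Abel summation thus keeps the cancellation of the quadratic sum, and 3 = 2 + 1.\<close>

lemma norm_sum_wave_diff_le:
  assumes K: "weyl_bound t e K" and "0 \<le> e" "n \<le> 2 ^ j" "-2 \<le> p" "p < 2"
  shows "norm (\<Sum>k<n. wave (y + h) (p * 2 ^ j + int k) - wave y (p * 2 ^ j + int k))
    \<le> 3 * 2 ^ j * \<bar>h\<bar> * (K * (2 ^ j) powr (1/2 + e))"
proof -
  let ?M = "p * 2 ^ j" and ?P = "K * (2 ^ j) powr (1/2 + e)"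
  have n: "real n \<le> 2 ^ j" using assms(3) by (metis of_nat_le_iff of_nat_numeral of_nat_power)
  have P0: "0 \<le> ?P" using weyl_bound_pos[OF K] by simp
  have eq: "wave (y + h) m - wave y m = (cis (h * of_int m) - 1) * wave y m" for m
    by (simp add: wave_def algebra_simps cis_mult)
  have "norm (\<Sum>k<n. (cis (h * of_int (?M + int k)) - 1) * wave y (?M + int k)) \<le> ?P * (2 * 2 ^ j * \<bar>h\<bar> + real n * \<bar>h\<bar>)"
  proof (rule norm_abel_sum_le)
    show "norm (\<Sum>k<i. wave y (?M + int k)) \<le> ?P" if "i \<le> n" for i
      using norm_sum_wave_le[OF K assms(2)] that assms(3) by simp
    show "norm (cis (h * of_int (?M + int k)) - 1) \<le> 2 * 2 ^ j * \<bar>h\<bar>" if "k < n" for k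
    proof -
      have "-2 * 2 ^ j \<le> ?M" "?M \<le> 1 * 2 ^ j" using assms by (intro mult_right_mono; simp)+
      moreover have "int k < 2 ^ j" using that assms(3)
        by (metis less_le_trans of_nat_less_iff of_nat_numeral of_nat_power)
      ultimately have "\<bar>?M + int k\<bar> \<le> 2 * 2 ^ j" by linarith
      then have "real_of_int \<bar>?M + int k\<bar> \<le> real_of_int (2 * 2 ^ j)" by (rule of_int_le_iff[THEN iffD2])
      then have "\<bar>real_of_int (?M + int k)\<bar> \<le> 2 * 2 ^ j" by simp
      then have "\<bar>h\<bar> * \<bar>real_of_int (?M + int k)\<bar> \<le> \<bar>h\<bar> * (2 * 2 ^ j)" by (rule mult_left_mono) simp
      then show ?thesis
        using norm_cis_minus_one_le[of "h * of_int (?M + int k)"] unfolding abs_mult by (simp only: mult_ac)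
    qed
    show "norm (cis (h * of_int (?M + int (Suc k))) - 1 - (cis (h * of_int (?M + int k)) - 1)) \<le> \<bar>h\<bar>" for k
    proof -
      have "cis (h * of_int (?M + int (Suc k))) = cis (h * of_int (?M + int k)) * cis h"
        by (simp add: cis_mult algebra_simps)
      then have "cis (h * of_int (?M + int (Suc k))) - 1 - (cis (h * of_int (?M + int k)) - 1) = cis (h * of_int (?M + int k)) * (cis h - 1)"
        by (simp add: algebra_simps)
      then show ?thesis using norm_cis_minus_one_le[of h] by (simp only: norm_mult norm_cis mult_1_left)
    qed
  qed auto
  also have "\<dots> \<le> ?P * (2 * 2 ^ j * \<bar>h\<bar> + 2 ^ j * \<bar>h\<bar>)"
    using n P0 by (intro mult_left_mono add_left_mono mult_right_mono) auto
  finally show ?thesis unfolding eq by (simp add: algebra_simps)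
qed

lemma shell_sum_bounds:
  assumes b: "b < s"
  obtains B where "0 \<le> B"
    and "\<And>j x. norm (shell_sum j x) \<le> B * (2 ^ j) powr - b"
    and "\<And>j x y. norm (shell_sum j x - shell_sum j y) \<le> B * (2 ^ j) powr - b * (2 ^ j * dist x y)"
proof -
  \<comment> \<open>Two quadratic sums contribute 2^(j(1+2\<open>e\<close>)); divided by
    2^(j(1+\<open>s\<close>)) this is exactly 2^(-j\<open>b\<close>).\<close>
  define e where "e = (s - b) / 2"
  have e: "0 < e" "s - 2 * e = b" using b by (auto simp: e_def field_simps)
  obtain K where K: "weyl_bound t e K" using weyl[OF e(1)] by blast
  note K1 = weyl_bound_pos[OF K]
  define B where "B = 64 * C * K\<^sup>2"
  have B0: "0 \<le> B" using C_nonneg by (simp add: B_def)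
  have pw: "K * (2 ^ j) powr (1/2 + e) * (K * (2 ^ j) powr (1/2 + e)) / (2 ^ j) powr (1 + s) = K\<^sup>2 * (2 ^ j) powr - b" for j
  proof -
    have "(2 ^ j :: real) powr (1/2 + e) * (2 ^ j) powr (1/2 + e) / (2 ^ j) powr (1 + s) = (2 ^ j) powr (1/2 + e + (1/2 + e) - (1 + s))"
      by (simp only: powr_add powr_diff)
    also have "1/2 + e + (1/2 + e) - (1 + s) = - b" using e by simp
    finally have eq: "(2 ^ j :: real) powr (1/2 + e) * (2 ^ j) powr (1/2 + e) / (2 ^ j) powr (1 + s) = (2 ^ j) powr - b" .
    have "K * A * (K * A) / D = K\<^sup>2 * (A * A / D)" for A D :: real
      by (simp add: power2_eq_square)
    then show ?thesis by (simp only: eq)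
  qed
  have 1: "norm (shell_sum j x) \<le> B * (2 ^ j) powr - b" for j x
  proof -
    have "norm (shell_sum j x) \<le> 64 * C * (K * (2 ^ j) powr (1/2 + e)) * (K * (2 ^ j) powr (1/2 + e)) / (2 ^ j) powr (1 + s)"
      unfolding shell_sum_eq_wave using e by (intro norm_shell_sum_le norm_sum_wave_le[OF K]) auto
    also have "\<dots> = 64 * C * (K * (2 ^ j) powr (1/2 + e) * (K * (2 ^ j) powr (1/2 + e)) / (2 ^ j) powr (1 + s))"
      by (simp only: mult.assoc times_divide_eq_right)
    finally show ?thesis unfolding pw B_def by (simp only: mult.assoc)
  qed
  have 2: "norm (shell_sum j (y + h, z) - shell_sum j (y, z)) \<le> 3 * \<bar>h\<bar> * 2 ^ j * (B * (2 ^ j) powr - b)" for j y z h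
  proof -
    have "shell_sum j (y + h, z) - shell_sum j (y, z)
        = (\<Sum>m\<in>dyadic_shell j. a m * (wave (y + h) (fst m) - wave y (fst m)) * wave z (snd m))"
      unfolding shell_sum_eq_wave sum_subtractf[symmetric] by (simp add: algebra_simps)
    also have "norm \<dots> \<le> 64 * C * (3 * 2 ^ j * \<bar>h\<bar> * (K * (2 ^ j) powr (1/2 + e))) * (K * (2 ^ j) powr (1/2 + e)) / (2 ^ j) powr (1 + s)"
      using e by (intro norm_shell_sum_le norm_sum_wave_le[OF K] norm_sum_wave_diff_le[OF K]) auto
    also have "\<dots> = 3 * 2 ^ j * \<bar>h\<bar> * 64 * C * (K * (2 ^ j) powr (1/2 + e) * (K * (2 ^ j) powr (1/2 + e)) / (2 ^ j) powr (1 + s))"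
      by (simp only: mult_ac times_divide_eq_right)
    finally show ?thesis unfolding pw B_def by (simp only: mult_ac)
  qed
  have 3: "norm (shell_sum j (z, y + h) - shell_sum j (z, y)) \<le> 3 * \<bar>h\<bar> * 2 ^ j * (B * (2 ^ j) powr - b)" for j y z h
  proof -
    have "shell_sum j (z, y + h) - shell_sum j (z, y)
        = (\<Sum>m\<in>dyadic_shell j. a m * wave z (fst m) * (wave (y + h) (snd m) - wave y (snd m)))"
      unfolding shell_sum_eq_wave sum_subtractf[symmetric] by (simp add: algebra_simps)
    also have "norm \<dots> \<le> 64 * C * (K * (2 ^ j) powr (1/2 + e)) * (3 * 2 ^ j * \<bar>h\<bar> * (K * (2 ^ j) powr (1/2 + e))) / (2 ^ j) powr (1 + s)"
      using e by (intro norm_shell_sum_le norm_sum_wave_le[OF K] norm_sum_wave_diff_le[OF K]) auto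
    also have "\<dots> = 3 * 2 ^ j * \<bar>h\<bar> * 64 * C * (K * (2 ^ j) powr (1/2 + e) * (K * (2 ^ j) powr (1/2 + e)) / (2 ^ j) powr (1 + s))"
      by (simp only: mult_ac times_divide_eq_right)
    finally show ?thesis unfolding pw B_def by (simp only: mult_ac)
  qed
  \<comment> \<open>The coordinates are moved one at a time. Each displacement is at most
    \<open>dist x y\<close>, which doubles the 3 to 6.\<close>
  have 4: "norm (shell_sum j x - shell_sum j y) \<le> (6 * B) * (2 ^ j) powr - b * (2 ^ j * dist x y)" for j x y
  proof -
    obtain x1 x2 y1 y2 where xy: "x = (x1, x2)" "y = (y1, y2)" by (cases x; cases y)
    define W where "W = 2 ^ j * (B * (2 ^ j) powr - b)"
    have W: "0 \<le> W" using B0 by (simp add: W_def)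
    have "norm (shell_sum j x - shell_sum j y)
       = norm ((shell_sum j (y1 + (x1 - y1), x2) - shell_sum j (y1, x2)) + (shell_sum j (y1, y2 + (x2 - y2)) - shell_sum j (y1, y2)))"
      unfolding xy by simp
    also have "\<dots> \<le> 3 * \<bar>x1 - y1\<bar> * 2 ^ j * (B * (2 ^ j) powr - b) + 3 * \<bar>x2 - y2\<bar> * 2 ^ j * (B * (2 ^ j) powr - b)"
      by (intro norm_triangle_mono 2 3)
    also have "\<dots> = 3 * W * (\<bar>x1 - y1\<bar> + \<bar>x2 - y2\<bar>)" by (simp add: W_def algebra_simps)
    also have "\<dots> \<le> 3 * W * (dist x y + dist x y)"
      using dist_fst_le[of x y] dist_snd_le[of x y] W
      by (intro mult_left_mono add_mono) (auto simp: xy dist_real_def)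
    also have "\<dots> = (6 * B) * (2 ^ j) powr - b * (2 ^ j * dist x y)" by (simp add: W_def algebra_simps)
    finally show ?thesis .
  qed
  show ?thesis
  proof (rule that[of "6 * B"])
    show "norm (shell_sum j x) \<le> 6 * B * (2 ^ j) powr - b" for j x
    proof -
      have "B * (2 ^ j) powr - b \<le> (6 * B) * (2 ^ j) powr - b" using B0 by (intro mult_right_mono) auto
      then show ?thesis using 1[of j x] by linarith
    qed
  qed (use B0 4 in auto)
qed

text \<open>The shells are summed in their order, so this is the limit of the partial sums over
  dyadic squares. The initial term collects the four frequencies with both components in {-1,
  0}.\<close>

definition limit :: "real \<times> real \<Rightarrow> complex" where
  "limit x = partial_sum 0 x + (\<Sum>j. shell_sum j x)"

lemma partial_sum_eq: "partial_sum n x = partial_sum 0 x + (\<Sum>j<n. shell_sum j x)"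
  unfolding partial_sum_def shell_sum_def using sum_dyadic_square[of "\<lambda>m. coeff m * character m x" 0 n] by simp

lemma power_two_powr: "(2 ^ j) powr - q = (2 powr - q) ^ j" for q :: real
  by (simp add: powr_powr mult.commute flip: powr_realpow)

lemma two_powr_less_1: "0 < q \<Longrightarrow> 2 powr - q < (1::real)"
  using powr_less_mono[of "- q" 0 2] by simp

lemma uniform_limit_partial_sum: "uniform_limit UNIV partial_sum limit sequentially"
proof -
  have "s / 2 < s" using s by simp
  then obtain B where B: "0 \<le> B" "\<And>j x. norm (shell_sum j x) \<le> B * (2 ^ j) powr - (s/2)"
    using shell_sum_bounds by metis
  have "uniform_limit UNIV (\<lambda>n x. \<Sum>j<n. shell_sum j x) (\<lambda>x. \<Sum>j. shell_sum j x) sequentially"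
  proof (rule Weierstrass_m_test)
    show "summable (\<lambda>j. B * (2 powr - (s/2)) ^ j)"
      using s two_powr_less_1[of "s/2"] by (intro summable_mult summable_geometric) auto
  qed (use B(2) in \<open>auto simp: power_two_powr\<close>)
  then have "uniform_limit UNIV (\<lambda>n x. partial_sum 0 x + (\<Sum>j<n. shell_sum j x)) limit sequentially"
    unfolding limit_def[abs_def] by (intro uniform_limit_add uniform_limit_const)
  then show ?thesis unfolding partial_sum_eq[symmetric] by (simp add: eta_contract_eq)
qed

lemma shell_sum_sums: "(\<lambda>j. shell_sum j x) sums (limit x - partial_sum 0 x)"
proof -
  have "(\<lambda>n. partial_sum n x) \<longlonglongrightarrow> limit x"
    by (rule tendsto_uniform_limitI[OF uniform_limit_partial_sum]) simp
  then have "(\<lambda>n. partial_sum n x - partial_sum 0 x) \<longlonglongrightarrow> limit x - partial_sum 0 x"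
    by (intro tendsto_diff tendsto_const)
  moreover have "partial_sum n x - partial_sum 0 x = (\<Sum>j<n. shell_sum j x)" for n
    by (subst partial_sum_eq) simp
  ultimately show ?thesis unfolding sums_def by simp
qed

lemma continuous_limit: "continuous_on UNIV limit"
proof (rule uniform_limit_theorem[OF _ uniform_limit_partial_sum])
  show "\<forall>\<^sub>F n in sequentially. continuous_on UNIV (partial_sum n)"
    unfolding partial_sum_def[abs_def] character_def
    by (intro always_eventually allI continuous_intros)
qed simp

lemma torus_periodic_character: "torus_periodic (character m)"
proof -
  have "cis (of_int n * (y + 2 * pi)) = cis (of_int n * y)" for n y
    using cis_multiple_2pi[of "of_int n"] by (simp add: distrib_left mult.assoc flip: cis_mult) (metis cis_multiple_2pi Ints_of_int mult.commute mult.left_commute mult_1_right)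
  then show ?thesis unfolding torus_periodic_def character_eq_cis by simp
qed

lemma torus_periodic_limit: "torus_periodic limit"
  using torus_periodic_character
  unfolding torus_periodic_def limit_def partial_sum_def shell_sum_def by simp

text \<open>A shell is both bounded by 2^(-jb) and Lipschitz with constant 2^j times that.
  Interpolating, its increment is O(2^(-j(b-\<gamma>)) |x-y|^\<gamma>), and a \<open>b\<close>
  strictly between \<open>\<gamma>\<close> and \<open>s\<close> makes this summable over
  \<open>j\<close>.\<close>

lemma Holder_limit:
  assumes g: "0 < \<gamma>" "\<gamma> < s"
  obtains K where "0 \<le> K" "\<And>x y. norm (limit x - limit y) \<le> K * dist x y powr \<gamma>"
proof -
  define b where "b = (\<gamma> + s) / 2"
  have b: "\<gamma> < b" "b < s" using g by (auto simp: b_def)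
  obtain B where B: "0 \<le> B" "\<And>j x. norm (shell_sum j x) \<le> B * (2 ^ j) powr - b"
    "\<And>j x y. norm (shell_sum j x - shell_sum j y) \<le> B * (2 ^ j) powr - b * (2 ^ j * dist x y)"
    using shell_sum_bounds[OF b(2)] by blast
  define q where "q = (2::real) powr - (b - \<gamma>)"
  have q: "0 \<le> q" "q < 1" using two_powr_less_1[of "b - \<gamma>"] b by (auto simp: q_def)
  \<comment> \<open>A factor min(\<open>D\<close>, 1) is bounded by \<open>D\<close>^\<gamma>, where
    \<open>D\<close> stands for 2^j |x-y| in a shell and for |x-y| in the initial part.\<close>
  have interp: "norm u \<le> 2 * A * D powr \<gamma>" if "norm u \<le> 2 * A" "norm u \<le> 2 * A * D" "0 < D" for u :: complex and A D
  proof -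
    have A: "0 \<le> A" using that(1) norm_ge_zero[of u] by linarith
    have "norm u \<le> 2 * A * min D 1"
      using that A by (simp add: min_def)
    also have "min D 1 \<le> D powr \<gamma> * 1 powr (1 - \<gamma>)"
      using that g s by (intro min_le_weighted_geometric_mean) auto
    finally show ?thesis using A by (simp add: mult_left_mono)
  qed
  have sh: "norm (shell_sum j x - shell_sum j y) \<le> 2 * B * dist x y powr \<gamma> * q ^ j" if "x \<noteq> y" for j x y
  proof -
    have "norm (shell_sum j x - shell_sum j y) \<le> 2 * (B * (2 ^ j) powr - b) * (2 ^ j * dist x y) powr \<gamma>"
    proof (rule interp)
      show "norm (shell_sum j x - shell_sum j y) \<le> 2 * (B * (2 ^ j) powr - b)"
        using norm_triangle_ineq4[of "shell_sum j x" "shell_sum j y"] B(2)[of j x] B(2)[of j y] by linarith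
      have "0 \<le> B * (2 ^ j) powr - b * (2 ^ j * dist x y)" using B(1) by simp
      then show "norm (shell_sum j x - shell_sum j y) \<le> 2 * (B * (2 ^ j) powr - b) * (2 ^ j * dist x y)"
        using B(3)[of j x y] by (simp add: mult.assoc)
    qed (use that in auto)
    also have "\<dots> = 2 * B * dist x y powr \<gamma> * ((2 ^ j) powr - b * (2 ^ j) powr \<gamma>)"
      by (simp add: powr_mult)
    also have "(2 ^ j) powr - b * (2 ^ j) powr \<gamma> = q ^ j"
      unfolding q_def power_two_powr[symmetric] powr_add[symmetric] by simp
    finally show ?thesis .
  qed
  \<comment> \<open>Four frequencies, each with coefficient at most \<open>C\<close> and increment
    at most 2 |x-y|^\<gamma>, give the 8.\<close>
  have low: "norm (partial_sum 0 x - partial_sum 0 y) \<le> 8 * C * dist x y powr \<gamma>" if xy: "x \<noteq> y" for x y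
  proof -
    have summand: "norm (coeff m * character m x - coeff m * character m y) \<le> C * (2 * dist x y powr \<gamma>)"
      if m: "m \<in> dyadic_square 0" for m
    proof -
      have m': "\<bar>fst m\<bar> \<le> 1" "\<bar>snd m\<bar> \<le> 1" using m by (auto simp: dyadic_square_def)
      have "C / bracket m powr (1 + s) \<le> C / 1"
        using bracket_ge_1[of m] C_nonneg s by (intro divide_left_mono) (auto intro: ge_one_powr_ge_zero)
      then have c: "norm (coeff m) \<le> C"
        using a_le[of m] by (simp add: coeff_def norm_mult)
      have 1: "norm (character m x - character m y) \<le> 2 * 1"
        using norm_triangle_ineq4[of "character m x" "character m y"] by simp
      let ?t = "of_int (fst m) * (fst x - fst y) + of_int (snd m) * (snd x - snd y)"
      have "character m x - character m y = character m y * (cis ?t - 1)"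
        by (simp add: character_eq_cis cis_mult algebra_simps)
      then have "norm (character m x - character m y) \<le> \<bar>?t\<bar>"
        using norm_cis_minus_one_le[of ?t] by (simp only: norm_mult norm_character mult_1_left)
      also have "\<dots> \<le> \<bar>of_int (fst m) * (fst x - fst y)\<bar> + \<bar>of_int (snd m) * (snd x - snd y)\<bar>"
        by (rule abs_triangle_ineq)
      also have "\<dots> \<le> 1 * dist x y + 1 * dist x y"
        unfolding abs_mult using m' dist_fst_le[of x y] dist_snd_le[of x y]
        by (intro add_mono mult_mono) (auto simp: dist_real_def simp flip: of_int_abs)
      finally have 2: "norm (character m x - character m y) \<le> 2 * 1 * dist x y" by simp
      have "norm (character m x - character m y) \<le> 2 * dist x y powr \<gamma>"
        using interp[OF 1 2] xy by simp
      then have "norm (coeff m) * norm (character m x - character m y) \<le> C * (2 * dist x y powr \<gamma>)"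
        using c C_nonneg by (intro mult_mono) auto
      then show ?thesis by (simp add: norm_mult flip: right_diff_distrib)
    qed
    have "norm (partial_sum 0 x - partial_sum 0 y) \<le> (\<Sum>m\<in>dyadic_square 0. C * (2 * dist x y powr \<gamma>))"
      unfolding partial_sum_def sum_subtractf[symmetric] by (rule order_trans[OF norm_sum sum_mono]) (rule summand)
    also have "\<dots> = 8 * C * dist x y powr \<gamma>"
      by (simp add: dyadic_square_def card_cartesian_product)
    finally show ?thesis .
  qed
  have main: "norm (limit x - limit y) \<le> (8 * C + 2 * B / (1 - q)) * dist x y powr \<gamma>" for x y
  proof (cases "x = y")
    case False
    have "(\<lambda>j. shell_sum j x - shell_sum j y) sums ((limit x - partial_sum 0 x) - (limit y - partial_sum 0 y))"
      by (intro sums_diff shell_sum_sums)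
    moreover have geo: "(\<lambda>j. 2 * B * dist x y powr \<gamma> * q ^ j) sums (2 * B * dist x y powr \<gamma> * (1 / (1 - q)))"
      using q by (intro sums_mult geometric_sums) auto
    ultimately have "norm ((limit x - partial_sum 0 x) - (limit y - partial_sum 0 y)) \<le> 2 * B * dist x y powr \<gamma> * (1 / (1 - q))"
      using norm_suminf_le[of "\<lambda>j. shell_sum j x - shell_sum j y" "\<lambda>j. 2 * B * dist x y powr \<gamma> * q ^ j"] sh[OF False]
      by (simp add: sums_iff)
    moreover have "norm (limit x - limit y) \<le> norm ((limit x - partial_sum 0 x) - (limit y - partial_sum 0 y)) + norm (partial_sum 0 x - partial_sum 0 y)"
      using norm_triangle_ineq[of "(limit x - partial_sum 0 x) - (limit y - partial_sum 0 y)" "partial_sum 0 x - partial_sum 0 y"]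
      by (simp add: algebra_simps)
    ultimately show ?thesis using low[OF False] by (simp add: algebra_simps)
  qed simp
  show ?thesis by (rule that[OF _ main]) (use B(1) C_nonneg q in auto)
qed

end

section \<open>Square-integrable convergence\<close>

lemma cmod_add_squared_le: "(norm (u + w))\<^sup>2 \<le> 2 * (norm u)\<^sup>2 + 2 * (norm w)\<^sup>2" for u w :: complex
proof -
  have "(norm (u + w))\<^sup>2 \<le> (norm u + norm w)\<^sup>2"
    by (intro power_mono norm_triangle_ineq) auto
  also have "\<dots> \<le> 2 * (norm u)\<^sup>2 + 2 * (norm w)\<^sup>2"
    using zero_le_power2[of "norm u - norm w"] by (simp add: power2_eq_square algebra_simps)
  finally show ?thesis .
qed

lemma integrable_on_torus_square:
  fixes g :: "real \<times> real \<Rightarrow> 'a::banach"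
  assumes "continuous_on torus_square g"
  shows "g integrable_on torus_square"
  using assms unfolding torus_square_def by (rule integrable_continuous)

lemma set_integrable_torus_square:
  fixes g :: "real \<times> real \<Rightarrow> 'a::euclidean_space"
  assumes "continuous_on torus_square g"
  shows "set_integrable lebesgue torus_square g"
  using assms unfolding torus_square_def by (rule absolutely_integrable_continuous)

lemma set_lebesgue_integral_torus_square:
  fixes g :: "real \<times> real \<Rightarrow> 'a::euclidean_space"
  assumes "continuous_on torus_square g"
  shows "(LINT x:torus_square|lebesgue. g x) = integral torus_square g"
  by (rule set_lebesgue_integral_eq_integral(2)[OF set_integrable_torus_square[OF assms]])

lemma continuous_character [continuous_intros]: "continuous_on S (character m)"
  unfolding character_def[abs_def] by (intro continuous_intros)

lemma integral_cis_period:
  "integral {0..2 * pi} (\<lambda>x. cis (of_int n * x)) = (if n = 0 then complex_of_real (2 * pi) else 0)"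
proof (cases "n = 0")
  case False
  have "((\<lambda>x. cis (of_int n * x)) has_integral
      (cis (of_int n * (2 * pi)) / (\<i> * of_int n) - cis (of_int n * 0) / (\<i> * of_int n))) {0..2 * pi}"
  proof (rule fundamental_theorem_of_calculus)
    fix x assume "x \<in> {0..2 * pi}"
    have "((\<lambda>z. exp (\<i> * of_int n * z) / (\<i> * of_int n)) has_field_derivative exp (\<i> * of_int n * of_real x)) (at (of_real x))"
      using False by (auto intro!: derivative_eq_intros)
    from has_vector_derivative_real_field[OF this]
    show "((\<lambda>x. cis (of_int n * x) / (\<i> * of_int n)) has_vector_derivative cis (of_int n * x)) (at x within {0..2 * pi})"
      by (simp add: cis_conv_exp mult.assoc)
  qed simp
  moreover have "cis (of_int n * (2 * pi)) = 1"
    using cis_multiple_2pi[of "of_int n"] by (simp add: mult_ac)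
  ultimately show ?thesis using False by (simp add: integral_unique)
qed (simp add: scaleR_conv_of_real)

lemma integral_character:
  "integral torus_square (character m) = (if m = (0, 0) then complex_of_real ((2 * pi)\<^sup>2) else 0)"
proof -
  have "integral torus_square (character m)
      = integral {0..2 * pi} (\<lambda>x. integral {0..2 * pi} (\<lambda>y. character m (x, y)))"
    unfolding torus_square_def by (subst integral_prod_continuous) (auto intro: continuous_intros)
  also have "\<dots> = integral {0..2 * pi} (\<lambda>x. cis (of_int (fst m) * x)) * integral {0..2 * pi} (\<lambda>y. cis (of_int (snd m) * y))"
    by (simp add: character_eq_cis)
  also have "\<dots> = (if m = (0, 0) then complex_of_real ((2 * pi)\<^sup>2) else 0)"
    unfolding integral_cis_period by (cases m) (auto simp: power2_eq_square)
  finally show ?thesis .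
qed

lemma character_mult_cnj: "character m x * cnj (character n x) = character (m - n) x"
  by (simp add: character_eq_cis cis_cnj cis_mult algebra_simps)

lemma character_add: "character m (x + h) = character m h * character m x"
  by (simp add: character_eq_cis cis_mult algebra_simps)

lemma parseval_finite:
  assumes "finite F"
  shows "integral torus_square (\<lambda>x. (norm (\<Sum>m\<in>F. c m * character m x))\<^sup>2) = (2 * pi)\<^sup>2 * (\<Sum>m\<in>F. (norm (c m))\<^sup>2)"
proof -
  have char: "(character m has_integral (if m = (0, 0) then complex_of_real ((2 * pi)\<^sup>2) else 0)) torus_square" for m
    unfolding integral_character[symmetric]
    by (intro integrable_integral integrable_on_torus_square continuous_intros)
  have "((\<lambda>x. \<Sum>m\<in>F. \<Sum>n\<in>F. c m * cnj (c n) * character (m - n) x) has_integral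
      (\<Sum>m\<in>F. \<Sum>n\<in>F. c m * cnj (c n) * (if m - n = (0, 0) then complex_of_real ((2 * pi)\<^sup>2) else 0))) torus_square"
    by (intro has_integral_sum assms has_integral_mult_right char)
  also have "(\<lambda>x. \<Sum>m\<in>F. \<Sum>n\<in>F. c m * cnj (c n) * character (m - n) x)
     = (\<lambda>x. complex_of_real ((norm (\<Sum>m\<in>F. c m * character m x))\<^sup>2))"
    unfolding complex_norm_square cnj_sum sum_product by (simp add: character_mult_cnj[symmetric] mult_ac)
  also have "(\<Sum>m\<in>F. \<Sum>n\<in>F. c m * cnj (c n) * (if m - n = (0, 0) then complex_of_real ((2 * pi)\<^sup>2) else 0))
     = (\<Sum>m\<in>F. \<Sum>n\<in>F. if m = n then c m * cnj (c n) * complex_of_real ((2 * pi)\<^sup>2) else 0)"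
    by (intro sum.cong) (auto simp: prod_eq_iff)
  also have "\<dots> = complex_of_real ((2 * pi)\<^sup>2 * (\<Sum>m\<in>F. (norm (c m))\<^sup>2))"
  proof -
    have "complex_of_real ((norm (c m))\<^sup>2) = c m * cnj (c m)" for m by (rule complex_norm_square)
    then show ?thesis using assms by (simp add: sum_distrib_right mult.commute del: of_real_power)
  qed
  finally have "((\<lambda>x. complex_of_real ((norm (\<Sum>m\<in>F. c m * character m x))\<^sup>2)) has_integral
      complex_of_real ((2 * pi)\<^sup>2 * (\<Sum>m\<in>F. (norm (c m))\<^sup>2))) torus_square" .
  from has_integral_linear[OF this bounded_linear_Re] show ?thesis
    by (simp add: o_def integral_unique)
qed

lemma integral_norm_sq_triangle:
  fixes g h :: "real \<times> real \<Rightarrow> complex"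
  assumes "continuous_on torus_square g" "continuous_on torus_square h"
  shows "integral torus_square (\<lambda>x. (norm (g x + h x))\<^sup>2)
    \<le> 2 * integral torus_square (\<lambda>x. (norm (g x))\<^sup>2) + 2 * integral torus_square (\<lambda>x. (norm (h x))\<^sup>2)"
proof -
  have "integral torus_square (\<lambda>x. (norm (g x + h x))\<^sup>2)
     \<le> integral torus_square (\<lambda>x. 2 * (norm (g x))\<^sup>2 + 2 * (norm (h x))\<^sup>2)"
    using assms by (intro integral_le integrable_on_torus_square cmod_add_squared_le continuous_intros)
  also have "\<dots> = integral torus_square (\<lambda>x. 2 * (norm (g x))\<^sup>2) + integral torus_square (\<lambda>x. 2 * (norm (h x))\<^sup>2)"
    using assms by (intro Henstock_Kurzweil_Integration.integral_add integrable_on_torus_square continuous_intros)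
  finally show ?thesis by simp
qed

lemma integral_torus_square_bound:
  fixes g :: "real \<times> real \<Rightarrow> real"
  assumes "continuous_on torus_square g" "\<And>x. x \<in> torus_square \<Longrightarrow> g x \<le> B"
  shows "integral torus_square g \<le> (2 * pi)\<^sup>2 * B"
proof -
  have "integral torus_square g \<le> integral torus_square (\<lambda>x. B)"
    using assms by (intro integral_le integrable_on_torus_square continuous_intros)
  also have "\<dots> = (2 * pi)\<^sup>2 * B"
    by (simp add: torus_square_def content_Pair power2_eq_square)
  finally show ?thesis .
qed

section \<open>Uniqueness of the continuous version\<close>

lemma torus_periodic_int_shift:
  assumes "torus_periodic f"
  shows "f (x + of_int k * (2 * pi), y + of_int l * (2 * pi)) = f (x, y)"
proof -
  have per: "f (x + 2 * pi, y) = f (x, y)" "f (x, y + 2 * pi) = f (x, y)" for x y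
    using assms by (auto simp: torus_periodic_def)
  have n1: "f (x + real n * (2 * pi), y) = f (x, y)" for x y n
  proof (induction n)
    case (Suc n)
    show ?case using per(1)[of "x + real n * (2 * pi)" y] Suc by (simp add: algebra_simps)
  qed simp
  have n2: "f (x, y + real n * (2 * pi)) = f (x, y)" for x y n
  proof (induction n)
    case (Suc n)
    show ?case using per(2)[of x "y + real n * (2 * pi)"] Suc by (simp add: algebra_simps)
  qed simp
  have 1: "f (x + of_int k * (2 * pi), y) = f (x, y)" for x y
  proof (cases "0 \<le> k")
    case True
    then show ?thesis using n1[of x "nat k" y] by simp
  next
    case False
    then show ?thesis using n1[of "x + of_int k * (2 * pi)" "nat (- k)" y] by (simp add: algebra_simps)
  qed
  have 2: "f (x, y + of_int l * (2 * pi)) = f (x, y)" for x y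
  proof (cases "0 \<le> l")
    case True
    then show ?thesis using n2[of x y "nat l"] by simp
  next
    case False
    then show ?thesis using n2[of x "y + of_int l * (2 * pi)" "nat (- l)"] by (simp add: algebra_simps)
  qed
  show ?thesis using 1 2 by simp
qed

lemma torus_periodic_eqI:
  assumes "torus_periodic f" "torus_periodic g" "\<And>x. x \<in> torus_square \<Longrightarrow> f x = g x"
  shows "f = g"
proof
  fix z :: "real \<times> real"
  obtain x y where z: "z = (x, y)" by (cases z)
  define k where "k = \<lfloor>x / (2 * pi)\<rfloor>"
  define l where "l = \<lfloor>y / (2 * pi)\<rfloor>"
  have "of_int k \<le> x / (2 * pi)" "x / (2 * pi) \<le> of_int k + 1"
       "of_int l \<le> y / (2 * pi)" "y / (2 * pi) \<le> of_int l + 1"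
    unfolding k_def l_def by linarith+
  then have "(x - of_int k * (2 * pi), y - of_int l * (2 * pi)) \<in> torus_square"
    by (auto simp: torus_square_def field_simps)
  then have "f (x - of_int k * (2 * pi), y - of_int l * (2 * pi)) = g (x - of_int k * (2 * pi), y - of_int l * (2 * pi))"
    by (rule assms(3))
  then show "f z = g z"
    using torus_periodic_int_shift[OF assms(1), of "x - of_int k * (2 * pi)" k "y - of_int l * (2 * pi)" l]
      torus_periodic_int_shift[OF assms(2), of "x - of_int k * (2 * pi)" k "y - of_int l * (2 * pi)" l]
    by (simp add: z)
qed

text \<open>Both functions are mean-square limits of the same finite sums, so the integral of |v -
  w|^2 over the square is 0. Continuity turns this into equality on the square, and periodicity into
  equality on the plane.\<close>

lemma evolution_version_unique:
  assumes v: "evolution_version f t v" "continuous_on UNIV v"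
    and w: "evolution_version f t w" "continuous_on UNIV w"
  shows "v = w"
proof (rule torus_periodic_eqI)
  show "torus_periodic v" "torus_periodic w"
    using v(1) w(1) by (auto simp: evolution_version_def torus_L2_def)
  define S where "S F x = (\<Sum>m\<in>F. exp (\<i> * complex_of_real (normsq m * t)) * fourier_coeff f m * character m x)" for F x
  have cont [continuous_intros]: "continuous_on A (S F)" "continuous_on A v" "continuous_on A w" for A F
    unfolding S_def[abs_def] using v(2) w(2)
    by (auto intro!: continuous_intros intro: continuous_on_subset)
  have lim: "((\<lambda>F. integral torus_square (\<lambda>x. (norm (S F x - u x))\<^sup>2)) \<longlongrightarrow> 0) (finite_subsets_at_top UNIV)"
    if u: "evolution_version f t u" "\<And>A. continuous_on A u" for u
  proof -
    have "(LINT x:torus_square|lebesgue. (norm (S F x - u x))\<^sup>2) = integral torus_square (\<lambda>x. (norm (S F x - u x))\<^sup>2)" for F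
      by (intro set_lebesgue_integral_torus_square continuous_intros u)
    then show ?thesis using u(1) by (simp add: evolution_version_def S_def)
  qed
  define I where "I = integral torus_square (\<lambda>x. (norm (v x - w x))\<^sup>2)"
  have "I \<le> 2 * 0 + 2 * 0"
  proof (rule tendsto_lowerbound)
    show "((\<lambda>F. 2 * integral torus_square (\<lambda>x. (norm (S F x - v x))\<^sup>2)
       + 2 * integral torus_square (\<lambda>x. (norm (S F x - w x))\<^sup>2)) \<longlongrightarrow> 2 * 0 + 2 * 0) (finite_subsets_at_top UNIV)"
      by (intro tendsto_intros lim v w cont)
    have "I \<le> 2 * integral torus_square (\<lambda>x. (norm (S F x - v x))\<^sup>2) + 2 * integral torus_square (\<lambda>x. (norm (S F x - w x))\<^sup>2)" for F
      using integral_norm_sq_triangle[of "\<lambda>x. v x - S F x" "\<lambda>x. S F x - w x"]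
      by (simp add: I_def continuous_intros norm_minus_commute)
    then show "\<forall>\<^sub>F F in finite_subsets_at_top UNIV. I \<le> 2 * integral torus_square (\<lambda>x. (norm (S F x - v x))\<^sup>2)
       + 2 * integral torus_square (\<lambda>x. (norm (S F x - w x))\<^sup>2)" by simp
  qed simp
  moreover have "0 \<le> I" unfolding I_def by (intro integral_nonneg integrable_on_torus_square continuous_intros) simp
  ultimately have "I = 0" by simp
  then have "\<forall>x\<in>torus_square. (norm (v x - w x))\<^sup>2 = 0"
    unfolding I_def torus_square_def
    by (subst (asm) integral_cbox_eq_0_iff) (auto intro!: continuous_intros simp: box_ne_empty Basis_prod_def)
  then show "v x = w x" if "x \<in> torus_square" for x using that by simp
qed

text \<open>Once a continuous version exists, the second alternative in the choice is impossible, so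
  the chosen function is continuous and uniqueness identifies it.\<close>

lemma evolution_eqI:
  assumes "evolution_version f t v" "continuous_on UNIV v"
  shows "evolution f t = v"
proof -
  have "evolution_version f t (evolution f t) \<and>
     (continuous_on UNIV (evolution f t) \<or> \<not> (\<exists>w. evolution_version f t w \<and> continuous_on UNIV w))"
    unfolding evolution_def by (rule someI[of _ v]) (use assms in blast)
  then show ?thesis using evolution_version_unique[OF _ _ assms] assms by blast
qed

section \<open>Identification of the uniform limit with the evolution, and translates\<close>

context weyl_series
begin

lemma norm_coeff [simp]: "norm (coeff m) = norm (a m)"
  by (simp add: coeff_def norm_mult)

text \<open>A shell has O(4^j) frequencies, each contributing at most \<open>C\<close>^2
  2^(-2j(1+\<open>s\<close>)).\<close>

lemma sum_shell_norm_sq_le: "(\<Sum>m\<in>dyadic_shell j. (norm (a m))\<^sup>2) \<le> 16 * C\<^sup>2 * (2 powr - (2 * s)) ^ j"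
proof -
  have "(\<Sum>m\<in>dyadic_shell j. (norm (a m))\<^sup>2) \<le> (\<Sum>m\<in>dyadic_shell j. (C / (2 ^ j) powr (1 + s))\<^sup>2)"
  proof (intro sum_mono power_mono)
    fix m assume m: "m \<in> dyadic_shell j"
    have "C / bracket m powr (1 + s) \<le> C / (2 ^ j) powr (1 + s)"
      using bracket_dyadic_shell(1)[OF m] s C_nonneg bracket_pos[of m]
      by (intro divide_left_mono powr_mono2 mult_pos_pos) auto
    then show "norm (a m) \<le> C / (2 ^ j) powr (1 + s)" using a_le[of m] by linarith
  qed simp
  also have "\<dots> = real (card (dyadic_shell j)) * (C / (2 ^ j) powr (1 + s))\<^sup>2" by simp
  also have "\<dots> \<le> real (16 * 4 ^ j) * (C / (2 ^ j) powr (1 + s))\<^sup>2"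
    by (intro mult_right_mono of_nat_mono card_dyadic_shell_le) simp
  also have "\<dots> = 16 * C\<^sup>2 * ((2 ^ j) powr 2 / ((2 ^ j) powr (1 + s) * (2 ^ j) powr (1 + s)))"
    by (simp add: power_divide power2_eq_square flip: power_mult_distrib)
  also have "(2 ^ j) powr 2 / ((2 ^ j) powr (1 + s) * (2 ^ j) powr (1 + s)) = (2 ^ j :: real) powr (2 - ((1 + s) + (1 + s)))"
    by (simp only: powr_add powr_diff)
  also have "2 - ((1 + s) + (1 + s)) = - (2 * s)" by simp
  finally show ?thesis by (simp only: power_two_powr)
qed

lemma norm_sq_summable: "(\<lambda>m. (norm (a m))\<^sup>2) summable_on UNIV"
  by (rule summable_on_dyadic[of _ 0 "16 * C\<^sup>2" "2 powr - (2 * s)"])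
     (use sum_shell_norm_sq_le two_powr_less_1[of "2 * s"] s in auto)

lemma continuous_partial_sum [continuous_intros]: "continuous_on A (partial_sum n)"
  unfolding partial_sum_def[abs_def] by (intro continuous_intros)

lemma continuous_on_limit [continuous_intros]: "continuous_on A limit"
  using continuous_limit by (rule continuous_on_subset) simp

lemma eventually_partial_sum_close:
  assumes "0 < e"
  shows "\<forall>\<^sub>F n in sequentially. \<forall>x. norm (partial_sum n x - limit x) < e"
  using uniform_limitD[OF uniform_limit_partial_sum assms] by (simp add: dist_norm)

text \<open>Uniform convergence is known only along dyadic squares, whereas the limit runs over all
  finite sets. A finite set containing a large square splits into that square, handled by uniform
  convergence, and a remainder, handled by Parseval and square summability of the
  coefficients.\<close>

lemma L2_convergence:
  "((\<lambda>F. integral torus_square (\<lambda>x. (norm ((\<Sum>m\<in>F. coeff m * character m x) - limit x))\<^sup>2)) \<longlongrightarrow> 0)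
     (finite_subsets_at_top UNIV)"
proof (rule tendstoI)
  fix e :: real assume e: "0 < e"
  define c where "c = (2 * pi)\<^sup>2"
  have c: "0 < c" by (simp add: c_def)
  define d where "d = e / (8 * c)"
  have d: "0 < d" using e c by (simp add: d_def)
  define A where "A = (\<Sum>\<^sub>\<infinity>m. (norm (a m))\<^sup>2)"
  have "(sum (\<lambda>m. (norm (a m))\<^sup>2) \<longlongrightarrow> A) (finite_subsets_at_top UNIV)"
    using has_sum_infsum[OF norm_sq_summable] by (simp add: A_def has_sum_def)
  then have "\<forall>\<^sub>F F in finite_subsets_at_top UNIV. A - d < (\<Sum>m\<in>F. (norm (a m))\<^sup>2)"
    using d by (intro order_tendstoD(1)) auto
  then obtain X where X: "finite X" "\<And>Y. finite Y \<Longrightarrow> X \<subseteq> Y \<Longrightarrow> A - d < (\<Sum>m\<in>Y. (norm (a m))\<^sup>2)"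
    unfolding eventually_finite_subsets_at_top by auto
  obtain j0 where j0: "X \<subseteq> dyadic_square j0" using dyadic_square_cover[OF X(1)] by blast
  have "\<forall>\<^sub>F n in sequentially. j0 \<le> n \<and> (\<forall>x. norm (partial_sum n x - limit x) < sqrt d)"
    using d by (intro eventually_conj eventually_ge_at_top eventually_partial_sum_close) auto
  then obtain j where j: "j0 \<le> j" "\<And>x. norm (partial_sum j x - limit x) < sqrt d"
    by (auto simp: eventually_sequentially)
  have XQ: "X \<subseteq> dyadic_square j" using j0 dyadic_square_mono[OF j(1)] by blast
  have close: "integral torus_square (\<lambda>x. (norm (partial_sum j x - limit x))\<^sup>2) \<le> c * d"
    unfolding c_def
  proof (rule integral_torus_square_bound)
    show "(norm (partial_sum j x - limit x))\<^sup>2 \<le> d" for x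
      using power_mono[OF less_imp_le[OF j(2)[of x]], of 2] d by simp
  qed (intro continuous_intros)
  have main: "integral torus_square (\<lambda>x. (norm ((\<Sum>m\<in>F. coeff m * character m x) - limit x))\<^sup>2) < e"
    if F: "finite F" "dyadic_square j \<subseteq> F" for F
  proof -
    have split: "(\<Sum>m\<in>F. coeff m * character m x) = (\<Sum>m\<in>F - dyadic_square j. coeff m * character m x) + partial_sum j x" for x
      unfolding partial_sum_def using F by (intro sum.subset_diff) auto
    have "(\<Sum>m\<in>F. (norm (a m))\<^sup>2) = (\<Sum>m\<in>F - dyadic_square j. (norm (a m))\<^sup>2) + (\<Sum>m\<in>dyadic_square j. (norm (a m))\<^sup>2)"
      using F by (intro sum.subset_diff) auto
    moreover have "(\<Sum>m\<in>F. (norm (a m))\<^sup>2) \<le> A"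
      unfolding A_def using norm_sq_summable F by (intro finite_sum_le_infsum) auto
    ultimately have tail: "(\<Sum>m\<in>F - dyadic_square j. (norm (a m))\<^sup>2) \<le> d"
      using X(2)[OF _ XQ] by simp
    have "integral torus_square (\<lambda>x. (norm ((\<Sum>m\<in>F. coeff m * character m x) - limit x))\<^sup>2)
        = integral torus_square (\<lambda>x. (norm ((\<Sum>m\<in>F - dyadic_square j. coeff m * character m x) + (partial_sum j x - limit x)))\<^sup>2)"
      unfolding split by (simp add: add_diff_eq)
    also have "\<dots> \<le> 2 * integral torus_square (\<lambda>x. (norm (\<Sum>m\<in>F - dyadic_square j. coeff m * character m x))\<^sup>2)
        + 2 * integral torus_square (\<lambda>x. (norm (partial_sum j x - limit x))\<^sup>2)"
      by (intro integral_norm_sq_triangle continuous_intros)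
    also have "\<dots> \<le> 2 * (c * d) + 2 * (c * d)"
      using F tail close c by (intro add_mono mult_left_mono) (auto simp: parseval_finite c_def)
    also have "\<dots> < e" using e c by (simp add: d_def)
    finally show ?thesis .
  qed
  have "0 \<le> integral torus_square (\<lambda>x. (norm ((\<Sum>m\<in>F. coeff m * character m x) - limit x))\<^sup>2)" for F
    by (intro integral_nonneg integrable_on_torus_square continuous_intros) simp
  then show "\<forall>\<^sub>F F in finite_subsets_at_top UNIV.
      dist (integral torus_square (\<lambda>x. (norm ((\<Sum>m\<in>F. coeff m * character m x) - limit x))\<^sup>2)) 0 < e"
    unfolding eventually_finite_subsets_at_top
    by (intro exI[of _ "dyadic_square j"]) (use main in auto)
qed

lemma evolution_eq_limit:
  assumes "a = fourier_coeff f"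
  shows "evolution f t = limit"
proof (rule evolution_eqI[OF _ continuous_limit])
  have 1: "(LINT x:torus_square|lebesgue.
         (norm ((\<Sum>m\<in>F. exp (\<i> * complex_of_real (normsq m * t)) * fourier_coeff f m * character m x) - limit x))\<^sup>2)
     = integral torus_square (\<lambda>x. (norm ((\<Sum>m\<in>F. coeff m * character m x) - limit x))\<^sup>2)" for F
    unfolding coeff_def assms[symmetric]
    by (intro set_lebesgue_integral_torus_square continuous_intros)
  have "set_integrable lebesgue torus_square limit" "set_integrable lebesgue torus_square (\<lambda>x. (norm (limit x))\<^sup>2)"
    by (intro set_integrable_torus_square continuous_intros)+
  then have "torus_L2 limit"
    unfolding torus_L2_def set_borel_measurable_def
    using torus_periodic_limit by (auto simp: set_integrable_def)
  then show "evolution_version f t limit"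
    unfolding evolution_version_def 1 using L2_convergence by simp
qed

text \<open>Translation by \<open>h\<close> multiplies the m-th coefficient by
  \<open>character m h - 1\<close>. Parseval is applied to a partial sum so large that the rest is
  uniformly small; the factor 2 on the right comes from separating this error by the squared
  triangle inequality.\<close>

lemma bessel_shift:
  assumes F: "finite F"
  shows "(2 * pi)\<^sup>2 * (\<Sum>m\<in>F. (norm (a m))\<^sup>2 * (norm (character m h - 1))\<^sup>2)
    \<le> 2 * integral torus_square (\<lambda>x. (norm (limit (x + h) - limit x))\<^sup>2)"
proof (rule field_le_epsilon)
  fix e :: real assume e: "0 < e"
  define c where "c = (2 * pi)\<^sup>2"
  have c: "0 < c" by (simp add: c_def)
  \<comment> \<open>Chosen so that the error, pointwise at most 4\<open>d\<close>^2 in square,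
    contributes 2 \<open>c\<close> . 4\<open>d\<close>^2 = \<open>e\<close>.\<close>
  define d where "d = sqrt (e / (8 * c))"
  have d: "0 < d" using e c by (simp add: d_def)
  obtain j0 where j0: "F \<subseteq> dyadic_square j0" using dyadic_square_cover[OF F] by blast
  have "\<forall>\<^sub>F n in sequentially. j0 \<le> n \<and> (\<forall>x. norm (partial_sum n x - limit x) < d)"
    using d by (intro eventually_conj eventually_ge_at_top eventually_partial_sum_close) auto
  then obtain j where j: "j0 \<le> j" "\<And>x. norm (partial_sum j x - limit x) < d"
    by (auto simp: eventually_sequentially)
  have FQ: "F \<subseteq> dyadic_square j" using j0 dyadic_square_mono[OF j(1)] by blast
  define err where "err x = (partial_sum j (x + h) - limit (x + h)) - (partial_sum j x - limit x)" for x
  have cont: "continuous_on torus_square (\<lambda>x. g (x + h))" if "continuous_on UNIV g" for g :: "real \<times> real \<Rightarrow> complex"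
    by (rule continuous_on_compose2[OF that]) (auto intro: continuous_intros)
  have cerr [continuous_intros]: "continuous_on torus_square err"
    "continuous_on torus_square (\<lambda>x. limit (x + h))"
    unfolding err_def[abs_def] by (intro continuous_intros cont)+
  have err: "(norm (err x))\<^sup>2 \<le> 4 * d\<^sup>2" for x
  proof -
    have "norm (err x) \<le> 2 * d"
      unfolding err_def
      using norm_triangle_ineq4[of "partial_sum j (x + h) - limit (x + h)" "partial_sum j x - limit x"] j(2)[of x] j(2)[of "x + h"]
      by linarith
    then have "(norm (err x))\<^sup>2 \<le> (2 * d)\<^sup>2" by (intro power_mono) auto
    then show ?thesis by (simp add: power_mult_distrib)
  qed
  have shift: "partial_sum j (x + h) - partial_sum j x = (\<Sum>m\<in>dyadic_square j. (coeff m * (character m h - 1)) * character m x)" for x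
    unfolding partial_sum_def sum_subtractf[symmetric] by (simp add: character_add algebra_simps)
  have "(2 * pi)\<^sup>2 * (\<Sum>m\<in>F. (norm (a m))\<^sup>2 * (norm (character m h - 1))\<^sup>2)
     \<le> (2 * pi)\<^sup>2 * (\<Sum>m\<in>dyadic_square j. (norm (a m))\<^sup>2 * (norm (character m h - 1))\<^sup>2)"
    using FQ by (intro mult_left_mono sum_mono2) auto
  also have "\<dots> = integral torus_square (\<lambda>x. (norm (partial_sum j (x + h) - partial_sum j x))\<^sup>2)"
    unfolding shift by (subst parseval_finite) (auto simp: norm_mult power_mult_distrib)
  also have "\<dots> = integral torus_square (\<lambda>x. (norm ((limit (x + h) - limit x) + err x))\<^sup>2)"
    by (simp add: err_def algebra_simps)
  also have "\<dots> \<le> 2 * integral torus_square (\<lambda>x. (norm (limit (x + h) - limit x))\<^sup>2) + 2 * integral torus_square (\<lambda>x. (norm (err x))\<^sup>2)"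
    by (intro integral_norm_sq_triangle continuous_intros)
  also have "integral torus_square (\<lambda>x. (norm (err x))\<^sup>2) \<le> c * (4 * d\<^sup>2)"
    unfolding c_def by (intro integral_torus_square_bound err continuous_intros)
  also have "2 * (c * (4 * d\<^sup>2)) = e" using c e by (simp add: d_def)
  finally show "(2 * pi)\<^sup>2 * (\<Sum>m\<in>F. (norm (a m))\<^sup>2 * (norm (character m h - 1))\<^sup>2)
    \<le> 2 * integral torus_square (\<lambda>x. (norm (limit (x + h) - limit x))\<^sup>2) + e" by simp
qed

end

section \<open>Covering numbers of graphs\<close>

lemma One_plane_times_line: "(One :: (real \<times> real) \<times> real) = ((1, 1), 1)"
proof (rule euclidean_eqI)
  fix b :: "(real \<times> real) \<times> real" assume "b \<in> Basis"
  then show "One \<bullet> b = ((1, 1), 1) \<bullet> b" by (subst inner_sum_Basis) (auto simp: Basis_prod_def)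
qed

lemma mem_cube_iff:
  fixes x y z :: real
  shows "((x, y), z) \<in> cbox ((a, b), c) (((a, b), c) + \<epsilon> *\<^sub>R One) \<longleftrightarrow>
     a \<le> x \<and> x \<le> a + \<epsilon> \<and> b \<le> y \<and> y \<le> b + \<epsilon> \<and> c \<le> z \<and> z \<le> c + \<epsilon>"
  by (auto simp: One_plane_times_line cbox_Pair_eq)

lemma covering_number_le:
  assumes "finite A" "E \<subseteq> (\<Union>a\<in>A. cbox a (a + \<epsilon> *\<^sub>R One))"
  shows "covering_number E \<epsilon> \<le> card A"
  unfolding covering_number_def using assms by (intro Least_le) blast

text \<open>The least number is meaningful only when some finite cover exists. Compactness provides
  one by balls of radius \<epsilon>/2, and each of them lies in a cube of side \<epsilon> about the
  same centre.\<close>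

lemma covering_number_attained:
  fixes E :: "'a::euclidean_space set"
  assumes "compact E" "0 < \<epsilon>"
  obtains A where "finite A" "card A = covering_number E \<epsilon>" "E \<subseteq> (\<Union>a\<in>A. cbox a (a + \<epsilon> *\<^sub>R One))"
proof -
  obtain K where K: "finite K" "E \<subseteq> (\<Union>x\<in>K. ball x (\<epsilon>/2))"
    using assms compact_eq_totally_bounded[of E] by (meson half_gt_zero)
  define A where "A = (\<lambda>x. x - (\<epsilon>/2) *\<^sub>R One) ` K"
  have "E \<subseteq> (\<Union>a\<in>A. cbox a (a + \<epsilon> *\<^sub>R One))"
  proof
    fix y assume "y \<in> E"
    then obtain x where x: "x \<in> K" "norm (y - x) < \<epsilon>/2"
      using K by (auto simp: dist_norm norm_minus_commute)
    have "x \<bullet> b - \<epsilon>/2 \<le> y \<bullet> b \<and> y \<bullet> b \<le> x \<bullet> b - \<epsilon>/2 + \<epsilon>" if "b \<in> Basis" for b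
      using Basis_le_norm[OF that, of "y - x"] x(2) unfolding inner_diff_left by linarith
    then have "y \<in> cbox (x - (\<epsilon>/2) *\<^sub>R One) (x - (\<epsilon>/2) *\<^sub>R One + \<epsilon> *\<^sub>R One)"
      by (simp add: mem_box inner_diff_left inner_add_left)
    then show "y \<in> (\<Union>a\<in>A. cbox a (a + \<epsilon> *\<^sub>R One))" using x(1) by (auto simp: A_def)
  qed
  moreover have "finite A" using K by (simp add: A_def)
  ultimately have "\<exists>n. \<exists>A. finite A \<and> card A = n \<and> E \<subseteq> (\<Union>a\<in>A. cbox a (a + \<epsilon> *\<^sub>R One))" by blast
  from LeastI_ex[OF this] that show ?thesis unfolding covering_number_def by blast
qed

lemma floor_multiple_bounds:
  fixes x \<epsilon> :: real
  assumes "0 < \<epsilon>" "0 \<le> x"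
  shows "real (nat \<lfloor>x / \<epsilon>\<rfloor>) * \<epsilon> \<le> x" "x \<le> real (nat \<lfloor>x / \<epsilon>\<rfloor>) * \<epsilon> + \<epsilon>"
proof -
  have eq: "real (nat \<lfloor>x / \<epsilon>\<rfloor>) = of_int \<lfloor>x / \<epsilon>\<rfloor>" using assms by simp
  show "real (nat \<lfloor>x / \<epsilon>\<rfloor>) * \<epsilon> \<le> x" "x \<le> real (nat \<lfloor>x / \<epsilon>\<rfloor>) * \<epsilon> + \<epsilon>"
    unfolding eq using floor_divide_lower[OF assms(1), of x] floor_divide_upper[OF assms(1), of x]
    by (simp_all add: distrib_right)
qed

text \<open>Over each of the O(\<epsilon>^(-2)) squares of a grid the graph oscillates by
  O(\<epsilon>^\<gamma>), so a stack of O(\<epsilon>^(\<gamma>-1)) cubes covers that part.\<close>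

lemma covering_number_graph_le:
  fixes g :: "real \<times> real \<Rightarrow> real"
  assumes g: "\<And>x y. \<bar>g x - g y\<bar> \<le> K * dist x y powr \<gamma>" and \<gamma>: "0 < \<gamma>" "\<gamma> < 1" and K: "0 \<le> K"
    and \<epsilon>: "0 < \<epsilon>" "\<epsilon> < 1"
  shows "real (covering_number (torus_graph g) \<epsilon>) \<le> (2 * pi + 1)\<^sup>2 * (4 * K + 1) * (1 / \<epsilon>) powr (3 - \<gamma>)"
proof -
  \<comment> \<open>Height of a stack: points of a grid square are within 2\<epsilon> of its lower
    left corner, so the values stay within \<open>H\<close>/2 of the corner value on either
    side.\<close>
  define H where "H = 2 * (K * (2 * \<epsilon>) powr \<gamma>)"
  have H0: "0 \<le> H" using K by (simp add: H_def)
  define n where "n = nat \<lfloor>2 * pi / \<epsilon>\<rfloor>"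
  define M where "M = nat \<lfloor>H / \<epsilon>\<rfloor>"
  define p where "p = (\<lambda>(i::nat, j::nat, k::nat).
     ((real i * \<epsilon>, real j * \<epsilon>), g (real i * \<epsilon>, real j * \<epsilon>) - H / 2 + real k * \<epsilon>))"
  define A where "A = p ` ({..n} \<times> {..n} \<times> {..M})"
  have "torus_graph g \<subseteq> (\<Union>a\<in>A. cbox a (a + \<epsilon> *\<^sub>R One))"
  proof
    fix z assume "z \<in> torus_graph g"
    then obtain x y where z: "z = ((x, y), g (x, y))" and xy: "0 \<le> x" "x \<le> 2 * pi" "0 \<le> y" "y \<le> 2 * pi"
      by (auto simp: torus_graph_def torus_square_def)
    define i where "i = nat \<lfloor>x / \<epsilon>\<rfloor>"
    define j where "j = nat \<lfloor>y / \<epsilon>\<rfloor>"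
    note ij = floor_multiple_bounds[OF \<epsilon>(1) xy(1), folded i_def] floor_multiple_bounds[OF \<epsilon>(1) xy(3), folded j_def]
    let ?c = "(real i * \<epsilon>, real j * \<epsilon>)"
    have "dist (x, y) ?c \<le> \<bar>x - real i * \<epsilon>\<bar> + \<bar>y - real j * \<epsilon>\<bar>"
      using sqrt_sum_squares_le_sum_abs[of "x - real i * \<epsilon>" "y - real j * \<epsilon>"] by (simp add: dist_Pair_Pair dist_real_def)
    also have "\<dots> \<le> 2 * \<epsilon>" using ij by linarith
    finally have "dist (x, y) ?c powr \<gamma> \<le> (2 * \<epsilon>) powr \<gamma>" using \<gamma> by (intro powr_mono2) auto
    then have "\<bar>g (x, y) - g ?c\<bar> \<le> H / 2"
      using g[of "(x, y)" ?c] mult_left_mono[OF _ K] unfolding H_def by fastforce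
    then have w: "0 \<le> g (x, y) - g ?c + H / 2" "g (x, y) - g ?c + H / 2 \<le> H" by linarith+
    define k where "k = nat \<lfloor>(g (x, y) - g ?c + H / 2) / \<epsilon>\<rfloor>"
    note kb = floor_multiple_bounds[OF \<epsilon>(1) w(1), folded k_def]
    have "i \<le> n" "j \<le> n"
      unfolding i_def j_def n_def using xy \<epsilon> by (intro nat_mono floor_mono divide_right_mono; simp)+
    moreover have "k \<le> M"
      unfolding k_def M_def using w \<epsilon> by (intro nat_mono floor_mono divide_right_mono) simp_all
    ultimately
    have "p (i, j, k) \<in> A" unfolding A_def by (intro imageI) auto
    moreover have "z \<in> cbox (p (i, j, k)) (p (i, j, k) + \<epsilon> *\<^sub>R One)"
      unfolding z p_def prod.case mem_cube_iff using ij kb by auto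
    ultimately show "z \<in> (\<Union>a\<in>A. cbox a (a + \<epsilon> *\<^sub>R One))" by blast
  qed
  then have "covering_number (torus_graph g) \<epsilon> \<le> card A"
    by (intro covering_number_le) (auto simp: A_def)
  also have "card A \<le> card ({..n} \<times> {..n} \<times> {..M})" unfolding A_def by (rule card_image_le) simp
  also have "\<dots> = (n + 1)\<^sup>2 * (M + 1)" by (simp add: card_cartesian_product power2_eq_square algebra_simps)
  finally have "real (covering_number (torus_graph g) \<epsilon>) \<le> real ((n + 1)\<^sup>2 * (M + 1))" by (rule of_nat_mono)
  also have "\<dots> = (real n + 1)\<^sup>2 * (real M + 1)" by (simp add: algebra_simps)
  also have "\<dots> \<le> ((2 * pi + 1) * (1 / \<epsilon>))\<^sup>2 * ((4 * K + 1) * (1 / \<epsilon>) powr (1 - \<gamma>))"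
  proof (intro mult_mono power_mono)
    have "real n \<le> 2 * pi / \<epsilon>" unfolding n_def using \<epsilon> by simp
    moreover have "1 \<le> 1 / \<epsilon>" using \<epsilon> by simp
    moreover have "(2 * pi + 1) * (1 / \<epsilon>) = 2 * pi / \<epsilon> + 1 / \<epsilon>" by (simp add: add_divide_distrib)
    ultimately show "real n + 1 \<le> (2 * pi + 1) * (1 / \<epsilon>)" by linarith
    have "real M \<le> H / \<epsilon>" unfolding M_def using \<epsilon> H0 by simp
    also have "H / \<epsilon> = 2 * K * 2 powr \<gamma> * (\<epsilon> powr \<gamma> / \<epsilon>)" using \<epsilon> by (simp add: H_def powr_mult)
    also have "\<epsilon> powr \<gamma> / \<epsilon> = (1 / \<epsilon>) powr (1 - \<gamma>)"
    proof -
      have "\<epsilon> powr \<gamma> / \<epsilon> = \<epsilon> powr - (1 - \<gamma>)" using \<epsilon> powr_diff[of \<epsilon> \<gamma> 1] by simp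
      also have "\<dots> = (1 / \<epsilon>) powr (1 - \<gamma>)"
        using powr_divide[of 1 \<epsilon> "1 - \<gamma>"] unfolding powr_minus by (simp add: inverse_eq_divide)
      finally show ?thesis .
    qed
    also have "2 * K * 2 powr \<gamma> * (1 / \<epsilon>) powr (1 - \<gamma>) \<le> 2 * K * 2 * (1 / \<epsilon>) powr (1 - \<gamma>)"
      using \<gamma> K powr_mono[of \<gamma> 1 "2::real"] by (intro mult_right_mono mult_left_mono) auto
    finally have "real M \<le> 4 * K * (1 / \<epsilon>) powr (1 - \<gamma>)" by simp
    moreover have "1 \<le> (1 / \<epsilon>) powr (1 - \<gamma>)" using \<epsilon> \<gamma> by (intro ge_one_powr_ge_zero) auto
    ultimately show "real M + 1 \<le> (4 * K + 1) * (1 / \<epsilon>) powr (1 - \<gamma>)" unfolding distrib_right by linarith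
  qed auto
  also have "\<dots> = (2 * pi + 1)\<^sup>2 * (4 * K + 1) * ((1 / \<epsilon>) powr 2 * (1 / \<epsilon>) powr (1 - \<gamma>))"
    using \<epsilon> by (simp only: power_mult_distrib powr_numeral zero_le_divide_1_iff less_imp_le mult_ac)
  also have "(1 / \<epsilon>) powr 2 * (1 / \<epsilon>) powr (1 - \<gamma>) = (1 / \<epsilon>) powr (3 - \<gamma>)"
    unfolding powr_add[symmetric] by simp
  finally show ?thesis .
qed

section \<open>From covering numbers to the fractal dimension and back\<close>

lemma eventually_at_right_0_unit: "\<forall>\<^sub>F \<epsilon> in at_right 0. 0 < \<epsilon> \<and> \<epsilon> < (1::real)"
  by (rule eventually_at_rightI[of 0 1]) auto

lemma ln_inverse_at_top: "filterlim (\<lambda>\<epsilon>::real. ln (1 / \<epsilon>)) at_top (at_right 0)"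
  using filterlim_compose[OF ln_at_top filterlim_inverse_at_top_right] by (simp add: inverse_eq_divide)

lemma fractal_dim_le:
  assumes D: "1 \<le> D" "0 \<le> d"
    and N: "\<And>\<epsilon>. 0 < \<epsilon> \<Longrightarrow> \<epsilon> < 1 \<Longrightarrow> real (covering_number E \<epsilon>) \<le> D * (1 / \<epsilon>) powr d"
  shows "fractal_dim E \<le> ereal d"
proof -
  have "fractal_dim E \<le> Limsup (at_right 0) (\<lambda>\<epsilon>. ereal (ln D / ln (1 / \<epsilon>) + d))"
    unfolding fractal_dim_def
  proof (rule Limsup_mono)
    show "\<forall>\<^sub>F \<epsilon> in at_right 0. ereal (ln (real (covering_number E \<epsilon>)) / ln (1 / \<epsilon>)) \<le> ereal (ln D / ln (1 / \<epsilon>) + d)"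
      using eventually_at_right_0_unit
    proof eventually_elim
      case (elim \<epsilon>)
      then have \<epsilon>: "0 < \<epsilon>" "\<epsilon> < 1" by auto
      then have lpos: "0 < ln (1 / \<epsilon>)" by simp
      have rhs: "ln (D * (1 / \<epsilon>) powr d) = ln D + d * ln (1 / \<epsilon>)"
        using D \<epsilon> by (subst ln_mult) (auto simp: ln_powr)
      have "ln (real (covering_number E \<epsilon>)) \<le> ln D + d * ln (1 / \<epsilon>)"
      \<comment> \<open>The logarithm is monotone only on positive arguments; at 0 its value is 0 by
        convention, and the bound holds because \<open>D\<close> \<ge> 1.\<close>
      proof (cases "covering_number E \<epsilon> = 0")
        case True
        then show ?thesis using D lpos by simp
      next
        case False
        then have "ln (real (covering_number E \<epsilon>)) \<le> ln (D * (1 / \<epsilon>) powr d)"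
          using N[OF \<epsilon>] by (intro ln_mono) auto
        then show ?thesis by (simp only: rhs)
      qed
      then show ?case using lpos by (simp add: field_simps)
    qed
  qed
  also have "\<dots> = ereal d"
  proof (rule lim_imp_Limsup)
    have "((\<lambda>\<epsilon>::real. ln D / ln (1 / \<epsilon>) + d) \<longlongrightarrow> 0 + d) (at_right 0)"
      by (intro tendsto_intros real_tendsto_divide_at_top[OF tendsto_const ln_inverse_at_top])
    then show "((\<lambda>\<epsilon>::real. ereal (ln D / ln (1 / \<epsilon>) + d)) \<longlongrightarrow> ereal d) (at_right 0)" by simp
  qed simp
  finally show ?thesis .
qed

lemma fractal_dim_graph_Holder_le:
  fixes g :: "real \<times> real \<Rightarrow> real"
  assumes g: "\<And>x y. \<bar>g x - g y\<bar> \<le> K * dist x y powr \<gamma>" and \<gamma>: "0 < \<gamma>" "\<gamma> < 1" and K: "0 \<le> K"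
  shows "fractal_dim (torus_graph g) \<le> ereal (3 - \<gamma>)"
proof (rule fractal_dim_le)
  have "1 * 1 \<le> (2 * pi + 1)\<^sup>2 * (4 * K + 1)"
    using K by (intro mult_mono) (auto simp: one_le_power)
  then show "1 \<le> (2 * pi + 1)\<^sup>2 * (4 * K + 1)" by simp
qed (use assms covering_number_graph_le[OF g \<gamma> K] in auto)

text \<open>Strict inequality for the upper limit gives the estimate at every small scale. The lower
  bound for the dimension needs this along all late dyadic scales, not merely along a
  subsequence.\<close>

lemma fractal_dim_less_eventually:
  assumes "fractal_dim E < ereal d"
  shows "\<forall>\<^sub>F \<epsilon> in at_right 0. real (covering_number E \<epsilon>) \<le> (1 / \<epsilon>) powr d"
proof -
  have "\<forall>\<^sub>F \<epsilon> in at_right 0. ereal (ln (real (covering_number E \<epsilon>)) / ln (1 / \<epsilon>)) < ereal d"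
    using assms unfolding fractal_dim_def by (rule Limsup_lessD)
  then show ?thesis
    using eventually_at_right_0_unit
  proof eventually_elim
    case (elim \<epsilon>)
    then have "0 < ln (1 / \<epsilon>)" by simp
    then have "ln (real (covering_number E \<epsilon>)) \<le> d * ln (1 / \<epsilon>)" using elim by (simp add: field_simps)
    also have "\<dots> = ln ((1 / \<epsilon>) powr d)" using elim by (simp add: ln_powr)
    finally have le: "ln (real (covering_number E \<epsilon>)) \<le> ln ((1 / \<epsilon>) powr d)" .
    show ?case
    proof (cases "covering_number E \<epsilon> = 0")
      case False
      then show ?thesis using le elim by (subst (asm) ln_le_cancel_iff) auto
    qed simp
  qed
qed

lemma compact_torus_graph:
  assumes "continuous_on UNIV g"
  shows "compact (torus_graph g)"
  unfolding torus_graph_def torus_square_def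
  using assms by (intro compact_continuous_image continuous_intros compact_cbox continuous_on_subset[OF assms]) auto

lemma interval_cover_length_le:
  fixes u v \<epsilon> :: real
  assumes "finite B" "{u..v} \<subseteq> (\<Union>b\<in>B. {c b..c b + \<epsilon>})" "u \<le> v" "0 \<le> \<epsilon>"
  shows "v - u \<le> real (card B) * \<epsilon>"
proof -
  have fm: "{c b..c b + \<epsilon>} \<in> fmeasurable lborel" for b by (simp add: fmeasurable_def emeasure_lborel_Icc_eq)
  have "v - u = measure lborel {u..v}" using assms by simp
  also have "\<dots> \<le> measure lborel (\<Union>b\<in>B. {c b..c b + \<epsilon>})"
    using assms(1,2) fm by (intro measure_mono_fmeasurable fmeasurable.finite_UN) auto
  also have "\<dots> \<le> (\<Sum>b\<in>B. measure lborel {c b..c b + \<epsilon>})"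
    using assms by (intro measure_UNION_le) auto
  also have "\<dots> = real (card B) * \<epsilon>" using assms by simp
  finally show ?thesis .
qed

text \<open>By the intermediate value theorem the cubes meeting the graph over the segment from \<open>x\<close> to
  \<open>x + h\<close> project onto a cover of the interval between \<open>g x\<close> and \<open>g (x + h)\<close>.\<close>

lemma increment_le_cover:
  fixes g :: "real \<times> real \<Rightarrow> real"
  assumes g: "continuous_on UNIV g" and A: "finite A" and h: "0 \<le> h1" "0 \<le> h2" and \<epsilon>: "0 \<le> \<epsilon>"
    and cover: "\<And>\<tau>. 0 \<le> \<tau> \<Longrightarrow> \<tau> \<le> 1 \<Longrightarrow>
       \<exists>a\<in>A. ((x1 + \<tau> * h1, x2 + \<tau> * h2), g (x1 + \<tau> * h1, x2 + \<tau> * h2)) \<in> cbox a (a + \<epsilon> *\<^sub>R One)"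
  shows "\<bar>g (x1 + h1, x2 + h2) - g (x1, x2)\<bar> \<le> (\<Sum>a\<in>A. \<epsilon> * indicator (cbox (fst a - (h1, h2)) (fst a + (\<epsilon>, \<epsilon>))) (x1, x2))"
proof -
  \<comment> \<open>If the base of a cube contains a point of the segment, then the base extended by
    (\<open>h1\<close>, \<open>h2\<close>) to the lower left contains the starting point. This
    condition refers to the starting point alone, so it can be integrated over the torus.\<close>
  define B where "B = {a \<in> A. (x1, x2) \<in> cbox (fst a - (h1, h2)) (fst a + (\<epsilon>, \<epsilon>))}"
  define \<phi> where "\<phi> \<tau> = g (x1 + \<tau> * h1, x2 + \<tau> * h2)" for \<tau>
  have cont: "continuous_on {0..1} \<phi>"
    unfolding \<phi>_def by (rule continuous_on_compose2[OF g]) (auto intro!: continuous_intros)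
  define u where "u = min (\<phi> 0) (\<phi> 1)"
  define v where "v = max (\<phi> 0) (\<phi> 1)"
  have "{u..v} \<subseteq> (\<Union>b\<in>B. {snd b..snd b + \<epsilon>})"
  proof
    fix y assume "y \<in> {u..v}"
    then have "\<exists>\<tau>. 0 \<le> \<tau> \<and> \<tau> \<le> 1 \<and> \<phi> \<tau> = y"
      \<comment> \<open>The end values may come in either order, hence both forms of the
        intermediate value theorem.\<close>
      using IVT'[of \<phi> 0 y 1] IVT2'[of \<phi> 1 y 0] cont by (fastforce simp: u_def v_def min_def max_def split: if_splits)
    then obtain \<tau> where \<tau>: "0 \<le> \<tau>" "\<tau> \<le> 1" "\<phi> \<tau> = y" by blast
    from cover[OF \<tau>(1,2)] obtain a where a: "a \<in> A"
      "((x1 + \<tau> * h1, x2 + \<tau> * h2), y) \<in> cbox a (a + \<epsilon> *\<^sub>R One)"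
      unfolding \<phi>_def[symmetric] \<tau>(3) by blast
    obtain a1 a2 a3 where aeq: "a = ((a1, a2), a3)" by (cases a) auto
    have th: "0 \<le> \<tau> * h1" "\<tau> * h1 \<le> h1" "0 \<le> \<tau> * h2" "\<tau> * h2 \<le> h2"
      using \<tau> h by (auto intro: mult_left_le_one_le)
    have m: "a1 \<le> x1 + \<tau> * h1" "x1 + \<tau> * h1 \<le> a1 + \<epsilon>" "a2 \<le> x2 + \<tau> * h2" "x2 + \<tau> * h2 \<le> a2 + \<epsilon>" "a3 \<le> y" "y \<le> a3 + \<epsilon>"
      using a(2) unfolding aeq mem_cube_iff by auto
    have "a \<in> B" unfolding B_def using a(1) m th by (auto simp: aeq)
    moreover have "y \<in> {snd a..snd a + \<epsilon>}" using m by (simp add: aeq)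
    ultimately show "y \<in> (\<Union>b\<in>B. {snd b..snd b + \<epsilon>})" by blast
  qed
  then have 1: "v - u \<le> real (card B) * \<epsilon>"
    using A \<epsilon> by (intro interval_cover_length_le[where c = snd]) (auto simp: B_def u_def v_def)
  have 2: "\<bar>g (x1 + h1, x2 + h2) - g (x1, x2)\<bar> = v - u"
    by (auto simp: u_def v_def \<phi>_def)
  have 3: "real (card B) * \<epsilon> = (\<Sum>a\<in>A. \<epsilon> * indicator (cbox (fst a - (h1, h2)) (fst a + (\<epsilon>, \<epsilon>))) (x1, x2))"
  proof -
    have "(\<Sum>a\<in>A. \<epsilon> * indicator (cbox (fst a - (h1, h2)) (fst a + (\<epsilon>, \<epsilon>))) (x1, x2)) = (\<Sum>a\<in>B. \<epsilon>)"
    proof -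
      have "\<epsilon> * indicator S z = (if z \<in> S then \<epsilon> else 0)" for S and z :: "real \<times> real" by simp
      then show ?thesis unfolding B_def sum.inter_filter[OF A] by (intro sum.cong refl)
    qed
    then show ?thesis by simp
  qed
  show ?thesis unfolding 2 3[symmetric] by (rule 1)
qed

text \<open>Integrating the pointwise bound, each cube contributes \<epsilon> times the area of its
  extended base, at most 4\<epsilon>^2. With four translates of the cover this gives 16 \<epsilon>^3
  per cube.\<close>

lemma integral_increment_le_covering_number:
  fixes g :: "real \<times> real \<Rightarrow> real"
  assumes g: "continuous_on UNIV g" "torus_periodic g" and \<epsilon>: "0 < \<epsilon>" "\<epsilon> < 1"
    and h: "0 \<le> h1" "h1 \<le> \<epsilon>" "0 \<le> h2" "h2 \<le> \<epsilon>"
  shows "integral torus_square (\<lambda>x. \<bar>g (x + (h1, h2)) - g x\<bar>) \<le> 16 * \<epsilon> ^ 3 * real (covering_number (torus_graph g) \<epsilon>)"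
proof -
  obtain A where A: "finite A" "card A = covering_number (torus_graph g) \<epsilon>"
    "torus_graph g \<subseteq> (\<Union>a\<in>A. cbox a (a + \<epsilon> *\<^sub>R One))"
    by (rule covering_number_attained[OF compact_torus_graph[OF g(1)] \<epsilon>(1)])
  text \<open>Four translates of the cover, because the segment may leave the fundamental square.\<close>
  define tr where "tr = (\<lambda>((k::int, l::int), a::(real \<times> real) \<times> real). a + ((of_int k * (2 * pi), of_int l * (2 * pi)), 0))"
  define A' where "A' = tr ` (({0..1} \<times> {0..1}) \<times> A)"
  have A': "finite A'" using A by (simp add: A'_def)
  have "card A' \<le> card ((({0..1::int} \<times> {0..1::int}) \<times> A))" unfolding A'_def by (rule card_image_le) (use A in simp)
  then have cA': "card A' \<le> 4 * card A" by (simp add: card_cartesian_product)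
  have cover: "\<exists>a\<in>A'. ((y1, y2), g (y1, y2)) \<in> cbox a (a + \<epsilon> *\<^sub>R One)"
    if y: "0 \<le> y1" "y1 \<le> 4 * pi" "0 \<le> y2" "y2 \<le> 4 * pi" for y1 y2
  proof -
    define k where "k = (if y1 \<le> 2 * pi then 0 else 1 :: int)"
    define l where "l = (if y2 \<le> 2 * pi then 0 else 1 :: int)"
    define z1 where "z1 = y1 - of_int k * (2 * pi)"
    define z2 where "z2 = y2 - of_int l * (2 * pi)"
    have "0 \<le> z1" "z1 \<le> 2 * pi" "0 \<le> z2" "z2 \<le> 2 * pi"
      using y by (auto simp: z1_def z2_def k_def l_def)
    then have "((z1, z2), g (z1, z2)) \<in> torus_graph g"
      by (auto simp: torus_graph_def torus_square_def)
    then obtain a where a: "a \<in> A" "((z1, z2), g (z1, z2)) \<in> cbox a (a + \<epsilon> *\<^sub>R One)" using A by blast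
    obtain a1 a2 a3 where aeq: "a = ((a1, a2), a3)" by (cases a) auto
    have gz: "g (z1, z2) = g (y1, y2)"
      using torus_periodic_int_shift[OF g(2), of z1 k z2 l] by (simp add: z1_def z2_def)
    have "tr ((k, l), a) = ((a1 + of_int k * (2 * pi), a2 + of_int l * (2 * pi)), a3)"
      by (simp add: tr_def aeq)
    then have "((y1, y2), g (y1, y2)) \<in> cbox (tr ((k, l), a)) (tr ((k, l), a) + \<epsilon> *\<^sub>R One)"
      using a(2) unfolding aeq by (simp only: mem_cube_iff gz) (simp add: z1_def z2_def)
    moreover have "tr ((k, l), a) \<in> A'" unfolding A'_def using a(1) by (intro imageI) (auto simp: k_def l_def)
    ultimately show ?thesis by blast
  qed
  define W where "W a = cbox (fst a - (h1, h2)) (fst a + (\<epsilon>, \<epsilon>))" for a :: "(real \<times> real) \<times> real"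
  have mW: "measure lebesgue (W a) \<le> 4 * \<epsilon>\<^sup>2" for a
  proof -
    obtain a1 a2 a3 where aeq: "a = ((a1, a2), a3)" by (cases a) auto
    have "measure lebesgue (W a) = (\<epsilon> + h1) * (\<epsilon> + h2)"
      using \<epsilon> h by (simp add: W_def aeq content_Pair)
    also have "\<dots> \<le> (2 * \<epsilon>) * (2 * \<epsilon>)" using \<epsilon> h by (intro mult_mono) auto
    finally show ?thesis by (simp add: power2_eq_square)
  qed
  have iW: "integrable lebesgue (\<lambda>x. \<epsilon> * indicator (W a) x)" for a
    by (intro integrable_mult_right integrable_real_indicator) (auto simp: W_def emeasure_lborel_cbox_eq)
  have cont: "continuous_on torus_square (\<lambda>x. \<bar>g (x + (h1, h2)) - g x\<bar>)"
    by (intro continuous_intros continuous_on_compose2[OF g(1)] continuous_on_subset[OF g(1)]) auto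
  then have si: "set_integrable lebesgue torus_square (\<lambda>x. \<bar>g (x + (h1, h2)) - g x\<bar>)"
    unfolding torus_square_def by (rule absolutely_integrable_continuous)
  have "integral torus_square (\<lambda>x. \<bar>g (x + (h1, h2)) - g x\<bar>) = (LINT x:torus_square|lebesgue. \<bar>g (x + (h1, h2)) - g x\<bar>)"
    using set_lebesgue_integral_eq_integral(2)[OF si] by simp
  also have "\<dots> \<le> (LINT x|lebesgue. (\<Sum>a\<in>A'. \<epsilon> * indicator (W a) x))"
    unfolding set_lebesgue_integral_def
  proof (rule integral_mono)
    show "integrable lebesgue (\<lambda>x. indicat_real torus_square x *\<^sub>R \<bar>g (x + (h1, h2)) - g x\<bar>)"
      using si by (simp add: set_integrable_def)
    show "integrable lebesgue (\<lambda>x. \<Sum>a\<in>A'. \<epsilon> * indicator (W a) x)"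
      by (intro Bochner_Integration.integrable_sum iW)
    fix x :: "real \<times> real"
    have nn: "0 \<le> (\<Sum>a\<in>A'. \<epsilon> * indicator (W a) x)" using \<epsilon> by (intro sum_nonneg) auto
    show "indicat_real torus_square x *\<^sub>R \<bar>g (x + (h1, h2)) - g x\<bar> \<le> (\<Sum>a\<in>A'. \<epsilon> * indicator (W a) x)"
    proof (cases "x \<in> torus_square")
      case True
      obtain x1 x2 where x: "x = (x1, x2)" by (cases x)
      have xb: "0 \<le> x1" "x1 \<le> 2 * pi" "0 \<le> x2" "x2 \<le> 2 * pi" using True by (auto simp: x torus_square_def)
      have "\<bar>g (x1 + h1, x2 + h2) - g (x1, x2)\<bar> \<le> (\<Sum>a\<in>A'. \<epsilon> * indicator (cbox (fst a - (h1, h2)) (fst a + (\<epsilon>, \<epsilon>))) (x1, x2))"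
      proof (rule increment_le_cover[OF g(1) A' h(1,3)])
        fix \<tau> :: real assume \<tau>: "0 \<le> \<tau>" "\<tau> \<le> 1"
        have "0 \<le> \<tau> * h1" "\<tau> * h1 \<le> h1" "0 \<le> \<tau> * h2" "\<tau> * h2 \<le> h2"
          using \<tau> h by (auto intro: mult_left_le_one_le)
        then show "\<exists>a\<in>A'. ((x1 + \<tau> * h1, x2 + \<tau> * h2), g (x1 + \<tau> * h1, x2 + \<tau> * h2)) \<in> cbox a (a + \<epsilon> *\<^sub>R One)"
          using xb h \<epsilon> pi_gt3 by (intro cover) linarith+
      qed (use \<epsilon> in simp)
      then show ?thesis using True by (simp add: x W_def)
    qed (use nn in simp)
  qed
  also have "\<dots> = (\<Sum>a\<in>A'. \<epsilon> * measure lebesgue (W a))"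
    by (subst Bochner_Integration.integral_sum) (use iW in auto)
  also have "\<dots> \<le> (\<Sum>a\<in>A'. \<epsilon> * (4 * \<epsilon>\<^sup>2))" using mW \<epsilon> by (intro sum_mono mult_left_mono) auto
  also have "\<dots> = real (card A') * (\<epsilon> * (4 * \<epsilon>\<^sup>2))" by simp
  also have "\<dots> \<le> real (4 * card A) * (\<epsilon> * (4 * \<epsilon>\<^sup>2))"
    using \<epsilon> cA' by (intro mult_right_mono of_nat_mono) auto
  finally show ?thesis by (simp add: A(2) power2_eq_square power3_eq_cube mult_ac)
qed

section \<open>Dimension and Sobolev regularity\<close>

context weyl_series
begin

text \<open>One factor of the squared increment is bounded by K \<epsilon>^\<gamma>, the other by
  the increments of real and imaginary part, whose integrals are O(\<epsilon>^(3-d)) each. The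
  result is written in powers of 1/\<epsilon> to suit dyadic scales.\<close>

lemma shift_integral_le:
  assumes H: "0 \<le> K" "\<And>x y. norm (limit x - limit y) \<le> K * dist x y powr \<gamma>" and \<gamma>: "0 < \<gamma>"
    and \<epsilon>: "0 < \<epsilon>" "\<epsilon> < 1"
    and N: "real (covering_number (torus_graph (\<lambda>x. Re (limit x))) \<epsilon>) \<le> (1 / \<epsilon>) powr d"
      "real (covering_number (torus_graph (\<lambda>x. Im (limit x))) \<epsilon>) \<le> (1 / \<epsilon>) powr d"
    and h: "0 \<le> fst h" "0 \<le> snd h" "norm h \<le> \<epsilon>"
  shows "integral torus_square (\<lambda>x. (norm (limit (x + h) - limit x))\<^sup>2) \<le> 32 * K * (1 / \<epsilon>) powr - (\<gamma> + 3 - d)"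
proof -
  obtain h1 h2 where hh: "h = (h1, h2)" by (cases h)
  have hb: "0 \<le> h1" "h1 \<le> \<epsilon>" "0 \<le> h2" "h2 \<le> \<epsilon>"
    using h norm_fst_le[of h1 h2] norm_snd_le[of h2 h1] by (auto simp: hh)
  have cont: "continuous_on torus_square (\<lambda>x. limit (x + h))"
    by (rule continuous_on_compose2[OF continuous_limit]) (auto intro: continuous_intros)
  note [continuous_intros] = cont
  let ?R = "\<lambda>x. \<bar>Re (limit (x + h)) - Re (limit x)\<bar>" and ?I = "\<lambda>x. \<bar>Im (limit (x + h)) - Im (limit x)\<bar>"
  have pt: "(norm (limit (x + h) - limit x))\<^sup>2 \<le> K * \<epsilon> powr \<gamma> * (?R x + ?I x)" for x
  proof -
    have "norm (limit (x + h) - limit x) \<le> K * norm h powr \<gamma>" using H(2)[of "x + h" x] by (simp add: dist_norm)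
    also have "\<dots> \<le> K * \<epsilon> powr \<gamma>" using h(3) \<gamma> H(1) by (intro mult_left_mono powr_mono2) auto
    finally have 1: "norm (limit (x + h) - limit x) \<le> K * \<epsilon> powr \<gamma>" .
    have 2: "norm (limit (x + h) - limit x) \<le> ?R x + ?I x" using cmod_le[of "limit (x + h) - limit x"] by simp
    have "norm (limit (x + h) - limit x) * norm (limit (x + h) - limit x) \<le> K * \<epsilon> powr \<gamma> * (?R x + ?I x)"
      using 1 2 H(1) by (intro mult_mono) auto
    then show ?thesis by (simp only: power2_eq_square)
  qed
  have R: "integral torus_square ?R \<le> 16 * \<epsilon> ^ 3 * (1 / \<epsilon>) powr d"
  proof -
    have "integral torus_square ?R \<le> 16 * \<epsilon> ^ 3 * real (covering_number (torus_graph (\<lambda>x. Re (limit x))) \<epsilon>)"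
      unfolding hh using torus_periodic_limit \<epsilon> hb
      by (intro integral_increment_le_covering_number continuous_intros) (auto simp: torus_periodic_def)
    also have "\<dots> \<le> 16 * \<epsilon> ^ 3 * (1 / \<epsilon>) powr d" using \<epsilon> N by (intro mult_left_mono) auto
    finally show ?thesis .
  qed
  have I: "integral torus_square ?I \<le> 16 * \<epsilon> ^ 3 * (1 / \<epsilon>) powr d"
  proof -
    have "integral torus_square ?I \<le> 16 * \<epsilon> ^ 3 * real (covering_number (torus_graph (\<lambda>x. Im (limit x))) \<epsilon>)"
      unfolding hh using torus_periodic_limit \<epsilon> hb
      by (intro integral_increment_le_covering_number continuous_intros) (auto simp: torus_periodic_def)
    also have "\<dots> \<le> 16 * \<epsilon> ^ 3 * (1 / \<epsilon>) powr d" using \<epsilon> N by (intro mult_left_mono) auto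
    finally show ?thesis .
  qed
  have "integral torus_square (\<lambda>x. (norm (limit (x + h) - limit x))\<^sup>2) \<le> integral torus_square (\<lambda>x. K * \<epsilon> powr \<gamma> * (?R x + ?I x))"
    by (intro integral_le integrable_on_torus_square pt continuous_intros)
  also have "\<dots> = K * \<epsilon> powr \<gamma> * (integral torus_square ?R + integral torus_square ?I)"
    unfolding integral_mult_right
    by (subst Henstock_Kurzweil_Integration.integral_add) (auto intro!: integrable_on_torus_square continuous_intros)
  also have "\<dots> \<le> K * \<epsilon> powr \<gamma> * (16 * \<epsilon> ^ 3 * (1 / \<epsilon>) powr d + 16 * \<epsilon> ^ 3 * (1 / \<epsilon>) powr d)"
    using R I H(1) by (intro mult_left_mono add_mono) auto
  also have "\<dots> = 32 * K * (\<epsilon> powr \<gamma> * \<epsilon> powr 3 * (1 / \<epsilon>) powr d)"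
    using \<epsilon> by (simp add: algebra_simps)
  also have "\<epsilon> powr \<gamma> * \<epsilon> powr 3 * (1 / \<epsilon>) powr d = (1 / \<epsilon>) powr - (\<gamma> + 3 - d)"
  proof -
    have inv: "(1 / \<epsilon>) powr q = \<epsilon> powr - q" for q
      using powr_divide[of 1 \<epsilon> q] unfolding powr_minus by (simp add: inverse_eq_divide)
    show ?thesis unfolding inv powr_add[symmetric] by (simp add: algebra_simps)
  qed
  finally show ?thesis .
qed

text \<open>Some component of m lies between 2^i and 2^(i+1) in modulus, so its phase at this
  \<epsilon> lies between 1/2 and 1, away from the multiples of 2\<pi>. Two axis-parallel shifts
  therefore see the whole shell. Since |cis \<theta> - 1| \<ge> |\<theta>|/4 there, the bound is
  (1/8)^2.\<close>

lemma norm_character_axis_ge: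
  assumes m: "m \<in> dyadic_shell i" and \<epsilon>: "\<epsilon> = 1 / 2 ^ Suc i"
  shows "1 / 64 \<le> (norm (character m (\<epsilon>, 0) - 1))\<^sup>2 + (norm (character m (0, \<epsilon>) - 1))\<^sup>2"
proof -
  have one: "1 / 64 \<le> (norm (cis (of_int n * \<epsilon>) - 1))\<^sup>2" if n: "2 ^ i \<le> \<bar>n\<bar>" "\<bar>n\<bar> \<le> 2 ^ Suc i" for n
  proof -
    have "real_of_int (2 ^ i) \<le> real_of_int \<bar>n\<bar>" "real_of_int \<bar>n\<bar> \<le> real_of_int (2 ^ Suc i)"
      using n by (simp_all only: of_int_le_iff)
    then have "1 / 2 \<le> \<bar>of_int n * \<epsilon>\<bar>" "\<bar>of_int n * \<epsilon>\<bar> \<le> 1"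
      unfolding \<epsilon> by (simp_all add: abs_mult field_simps)
    moreover have "\<bar>of_int n * \<epsilon> / 2\<bar> / 4 \<le> \<bar>sin (of_int n * \<epsilon> / 2)\<bar>"
      using calculation pi_gt3 by (intro abs_le_abs_sin) simp
    ultimately have "1 / 8 \<le> norm (cis (of_int n * \<epsilon>) - 1)"
      unfolding norm_cis_minus_one by simp
    then have "(1 / 8)\<^sup>2 \<le> (norm (cis (of_int n * \<epsilon>) - 1))\<^sup>2" by (rule power_mono) simp
    then show ?thesis by (simp add: power2_eq_square)
  qed
  show ?thesis
    using dyadic_shell_component[OF m] one[of "fst m"] one[of "snd m"]
    by (auto simp: character_eq_cis intro: add_increasing add_increasing2)
qed

text \<open>The shifts at scale 2^(-i-1) bound the energy of the \<open>i\<close>-th shell by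
  O(2^(-i\<rho>)) with \<rho> = \<gamma>+3-d; weighted by 2^(2ri) this is a geometric series, as 2r
  < \<rho>.\<close>

lemma sobolev_summable:
  assumes dim: "fractal_dim (torus_graph (\<lambda>x. Re (limit x))) < ereal d" "fractal_dim (torus_graph (\<lambda>x. Im (limit x))) < ereal d"
    and \<gamma>: "0 < \<gamma>" "\<gamma> < s" and r: "2 * r < \<gamma> + 3 - d"
  shows "(\<lambda>m. bracket m powr (2 * r) * (norm (a m))\<^sup>2) summable_on UNIV"
proof -
  obtain K where K: "0 \<le> K" "\<And>x y. norm (limit x - limit y) \<le> K * dist x y powr \<gamma>"
    using Holder_limit[OF \<gamma>] by blast
  define \<rho> where "\<rho> = \<gamma> + 3 - d"
  define q where "q = (2::real) powr - \<rho>"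
  define \<epsilon> where "\<epsilon> i = 1 / (2::real) ^ Suc i" for i
  have \<epsilon>: "0 < \<epsilon> i" "\<epsilon> i < 1" for i
    using one_less_power[of "2::real" "Suc i"] by (simp_all add: \<epsilon>_def del: power_Suc)
  have inv_\<epsilon>: "(1 / \<epsilon> i) powr - \<rho> = q * q ^ i" for i
    unfolding \<epsilon>_def q_def using power_two_powr[of "Suc i" \<rho>] by simp
  have "filterlim \<epsilon> (at_right 0) sequentially"
  proof -
    have "(\<lambda>i. (1/2::real) ^ Suc i) \<longlonglongrightarrow> 0" by (intro LIMSEQ_Suc LIMSEQ_power_zero) simp
    then have "\<epsilon> \<longlonglongrightarrow> 0" by (simp add: \<epsilon>_def[abs_def] power_one_over)
    then show ?thesis unfolding filterlim_at by (simp add: \<epsilon> less_imp_le \<epsilon>(1)[THEN less_imp_neq, symmetric])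
  qed
  then have "\<forall>\<^sub>F i in sequentially. real (covering_number (torus_graph (\<lambda>x. Re (limit x))) (\<epsilon> i)) \<le> (1 / \<epsilon> i) powr d
      \<and> real (covering_number (torus_graph (\<lambda>x. Im (limit x))) (\<epsilon> i)) \<le> (1 / \<epsilon> i) powr d"
    unfolding filterlim_iff using dim[THEN fractal_dim_less_eventually] by (intro eventually_conj) blast+
  then obtain i0 where i0: "\<And>i. i0 \<le> i \<Longrightarrow> real (covering_number (torus_graph (\<lambda>x. Re (limit x))) (\<epsilon> i)) \<le> (1 / \<epsilon> i) powr d"
     "\<And>i. i0 \<le> i \<Longrightarrow> real (covering_number (torus_graph (\<lambda>x. Im (limit x))) (\<epsilon> i)) \<le> (1 / \<epsilon> i) powr d"
    unfolding eventually_sequentially by blast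
  have shift: "(\<Sum>m\<in>dyadic_shell i. (norm (a m))\<^sup>2 * (norm (character m h - 1))\<^sup>2) \<le> 32 * K * (q * q ^ i)"
    if i: "i0 \<le> i" and h: "0 \<le> fst h" "0 \<le> snd h" "norm h \<le> \<epsilon> i" for i h
  proof -
    let ?S = "\<Sum>m\<in>dyadic_shell i. (norm (a m))\<^sup>2 * (norm (character m h - 1))\<^sup>2"
    \<comment> \<open>The normalisation (2\<pi>)^2 of Parseval exceeds 2 and absorbs the factor 2 of
      \<open>bessel_shift\<close>.\<close>
    have "2 * 1 \<le> (2 * pi)\<^sup>2" using pi_gt3 power_mono[of 3 pi 2] by (simp add: power_mult_distrib)
    then have "2 * 1 * ?S \<le> (2 * pi)\<^sup>2 * ?S" by (intro mult_right_mono sum_nonneg) auto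
    also have "\<dots> \<le> 2 * integral torus_square (\<lambda>x. (norm (limit (x + h) - limit x))\<^sup>2)"
      by (rule bessel_shift) simp
    also have "\<dots> \<le> 2 * (32 * K * (1 / \<epsilon> i) powr - \<rho>)"
      unfolding \<rho>_def using i0[OF i] K \<gamma> \<epsilon> h by (intro mult_left_mono shift_integral_le) auto
    finally show ?thesis by (simp add: inv_\<epsilon>)
  qed
  have shell: "(\<Sum>m\<in>dyadic_shell i. (norm (a m))\<^sup>2) \<le> 4096 * K * q * q ^ i" if i: "i0 \<le> i" for i
  proof -
    have "(\<Sum>m\<in>dyadic_shell i. (norm (a m))\<^sup>2) \<le> (\<Sum>m\<in>dyadic_shell i. 64 *
        ((norm (a m))\<^sup>2 * (norm (character m (\<epsilon> i, 0) - 1))\<^sup>2 + (norm (a m))\<^sup>2 * (norm (character m (0, \<epsilon> i) - 1))\<^sup>2))"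
    proof (rule sum_mono)
      fix m assume m: "m \<in> dyadic_shell i"
      have "(norm (a m))\<^sup>2 * (1 / 64) \<le> (norm (a m))\<^sup>2 * ((norm (character m (\<epsilon> i, 0) - 1))\<^sup>2 + (norm (character m (0, \<epsilon> i) - 1))\<^sup>2)"
        by (intro mult_left_mono norm_character_axis_ge[OF m \<epsilon>_def]) simp
      then show "(norm (a m))\<^sup>2 \<le> 64 *
        ((norm (a m))\<^sup>2 * (norm (character m (\<epsilon> i, 0) - 1))\<^sup>2 + (norm (a m))\<^sup>2 * (norm (character m (0, \<epsilon> i) - 1))\<^sup>2)"
        unfolding distrib_left by linarith
    qed
    also have "\<dots> = 64 * ((\<Sum>m\<in>dyadic_shell i. (norm (a m))\<^sup>2 * (norm (character m (\<epsilon> i, 0) - 1))\<^sup>2)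
        + (\<Sum>m\<in>dyadic_shell i. (norm (a m))\<^sup>2 * (norm (character m (0, \<epsilon> i) - 1))\<^sup>2))"
      by (simp only: sum_distrib_left[symmetric] sum.distrib)
    also have "\<dots> \<le> 64 * (32 * K * (q * q ^ i) + 32 * K * (q * q ^ i))"
      using \<epsilon>[of i] by (intro mult_left_mono add_mono shift i) (auto simp: norm_Pair)
    finally show ?thesis by (simp add: algebra_simps)
  qed
  \<comment> \<open>The exponent may have either sign. The quotient of the bracket by 2^i lies
    between 1 and 4, so passing to the absolute value of the exponent covers both cases.\<close>
  have br: "bracket m powr (2 * r) \<le> 4 powr \<bar>2 * r\<bar> * (2 powr (2 * r)) ^ i" if m: "m \<in> dyadic_shell i" for m i
  proof -
    define L where "L = (2::real) ^ i"
    have L: "0 < L" by (simp add: L_def)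
    have bL: "1 \<le> bracket m / L" "bracket m / L \<le> 4"
      using bracket_dyadic_shell[OF m] L by (simp_all add: L_def field_simps)
    have "bracket m powr (2 * r) = (bracket m / L * L) powr (2 * r)" using L by simp
    also have "\<dots> = (bracket m / L) powr (2 * r) * L powr (2 * r)" by (rule powr_mult)
    also have "\<dots> \<le> 4 powr \<bar>2 * r\<bar> * L powr (2 * r)"
    proof (rule mult_right_mono)
      have "(bracket m / L) powr (2 * r) \<le> (bracket m / L) powr \<bar>2 * r\<bar>" using bL by (intro powr_mono) auto
      also have "\<dots> \<le> 4 powr \<bar>2 * r\<bar>" using bL by (intro powr_mono2) auto
      finally show "(bracket m / L) powr (2 * r) \<le> 4 powr \<bar>2 * r\<bar>" .
    qed simp
    also have "L powr (2 * r) = (2 powr (2 * r)) ^ i"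
      unfolding L_def using power_two_powr[of i "- (2 * r)"] by simp
    finally show ?thesis .
  qed
  show ?thesis
  proof (rule summable_on_dyadic[of _ i0 "4 powr \<bar>2 * r\<bar> * (4096 * K * q)" "2 powr (2 * r) * q"])
    fix i assume i: "i0 \<le> i"
    have "(\<Sum>m\<in>dyadic_shell i. bracket m powr (2 * r) * (norm (a m))\<^sup>2)
       \<le> (\<Sum>m\<in>dyadic_shell i. 4 powr \<bar>2 * r\<bar> * (2 powr (2 * r)) ^ i * (norm (a m))\<^sup>2)"
      by (intro sum_mono mult_right_mono br) auto
    also have "\<dots> = 4 powr \<bar>2 * r\<bar> * (2 powr (2 * r)) ^ i * (\<Sum>m\<in>dyadic_shell i. (norm (a m))\<^sup>2)"
      by (simp only: sum_distrib_left)
    also have "\<dots> \<le> 4 powr \<bar>2 * r\<bar> * (2 powr (2 * r)) ^ i * (4096 * K * q * q ^ i)"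
      by (intro mult_left_mono shell[OF i]) simp
    also have "\<dots> = 4 powr \<bar>2 * r\<bar> * (4096 * K * q) * (2 powr (2 * r) * q) ^ i"
      by (simp add: power_mult_distrib mult_ac)
    finally show "(\<Sum>m\<in>dyadic_shell i. bracket m powr (2 * r) * (norm (a m))\<^sup>2)
        \<le> 4 powr \<bar>2 * r\<bar> * (4096 * K * q) * (2 powr (2 * r) * q) ^ i" .
  next
    have "2 powr (2 * r) * q = 2 powr - (\<rho> - 2 * r)" by (simp add: q_def flip: powr_add)
    then show "2 powr (2 * r) * q < 1" using two_powr_less_1[of "\<rho> - 2 * r"] r by (simp add: \<rho>_def)
  qed (auto simp: q_def)
qed

lemma fractal_dim_limit_le:
  "fractal_dim (torus_graph (\<lambda>x. Re (limit x))) \<le> ereal (3 - s)"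
  "fractal_dim (torus_graph (\<lambda>x. Im (limit x))) \<le> ereal (3 - s)"
proof -
  have main: "fractal_dim (torus_graph (\<lambda>x. Re (limit x))) \<le> ereal (3 - s) + ereal e \<and>
     fractal_dim (torus_graph (\<lambda>x. Im (limit x))) \<le> ereal (3 - s) + ereal e" if e: "0 < e" for e
  proof -
    \<comment> \<open>Hoelder continuity is available only strictly below \<open>s\<close>, so an
      arbitrary \<open>e\<close> is lost; the maximum with \<open>s\<close>/2 keeps the exponent
      positive.\<close>
    define \<gamma> where "\<gamma> = max (s - e) (s / 2)"
    have \<gamma>: "0 < \<gamma>" "\<gamma> < s" "s - e \<le> \<gamma>" using s e by (auto simp: \<gamma>_def)
    obtain K where K: "0 \<le> K" "\<And>x y. norm (limit x - limit y) \<le> K * dist x y powr \<gamma>"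
      using Holder_limit[OF \<gamma>(1,2)] by blast
    have "\<bar>Re (limit x) - Re (limit y)\<bar> \<le> K * dist x y powr \<gamma>"
         "\<bar>Im (limit x) - Im (limit y)\<bar> \<le> K * dist x y powr \<gamma>" for x y
      using K(2)[of x y] abs_Re_le_cmod[of "limit x - limit y"] abs_Im_le_cmod[of "limit x - limit y"] by simp_all
    then have "fractal_dim (torus_graph (\<lambda>x. Re (limit x))) \<le> ereal (3 - \<gamma>)"
         "fractal_dim (torus_graph (\<lambda>x. Im (limit x))) \<le> ereal (3 - \<gamma>)"
      using \<gamma> s K(1) by (intro fractal_dim_graph_Holder_le[where K = K]; simp)+
    moreover have "ereal (3 - \<gamma>) \<le> ereal (3 - s) + ereal e" using \<gamma> by simp
    ultimately show ?thesis by (meson order_trans)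
  qed
  show "fractal_dim (torus_graph (\<lambda>x. Re (limit x))) \<le> ereal (3 - s)"
       "fractal_dim (torus_graph (\<lambda>x. Im (limit x))) \<le> ereal (3 - s)"
    using main by (auto intro: ereal_le_epsilon2)
qed

lemma fractal_dim_limit_ge:
  assumes f: "a = fourier_coeff f"
  shows "ereal (3 + s) - 2 * sobolev_index f \<le> max (fractal_dim (torus_graph (\<lambda>x. Re (limit x))))
     (fractal_dim (torus_graph (\<lambda>x. Im (limit x))))" (is "_ \<le> ?D")
\<comment> \<open>Comparison with real upper bounds \<open>z\<close> reduces the claim to finite
  dimensions, while the Sobolev index may still be infinite.\<close>
proof (rule ereal_le_real)
  fix z assume z: "?D \<le> ereal z"
  have "ereal (3 + s) - 2 * sobolev_index f \<le> ereal z + ereal e" if e: "0 < e" for e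
  proof -
    define \<gamma> where "\<gamma> = max (s - e / 3) (s / 2)"
    have \<gamma>: "0 < \<gamma>" "\<gamma> < s" "s - e / 3 \<le> \<gamma>" using s e by (auto simp: \<gamma>_def)
    \<comment> \<open>Three losses of at most \<open>e\<close>/3: \<open>\<gamma>\<close> below
      \<open>s\<close>, \<open>d\<close> above \<open>z\<close>, and 2\<open>r\<close> strictly
      below \<gamma>+3-d.\<close>
    define d where "d = z + e / 3"
    define r where "r = (\<gamma> + 3 - d - e / 3) / 2"
    have "?D < ereal d" by (rule order_le_less_trans[OF z]) (use e in \<open>simp add: d_def\<close>)
    then have "in_sobolev r f"
      unfolding in_sobolev_def f[symmetric] using \<gamma> e by (intro sobolev_summable[of d \<gamma>]) (auto simp: r_def)
    then have "ereal r \<le> sobolev_index f" unfolding sobolev_index_def by (intro Sup_upper) auto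
    then have "2 * ereal r \<le> 2 * sobolev_index f" by (rule ereal_mult_left_mono) simp
    then have "ereal (3 + s) - 2 * sobolev_index f \<le> ereal (3 + s) - 2 * ereal r"
      by (intro ereal_minus_mono) auto
    also have "\<dots> = ereal (3 + s - 2 * r)" by simp
    also have "\<dots> \<le> ereal z + ereal e"
    proof -
      have "2 * r = \<gamma> + 3 - (z + e / 3) - e / 3" by (simp add: r_def d_def)
      then have "3 + s - 2 * r \<le> z + e" using \<gamma>(3) by linarith
      then show ?thesis by simp
    qed
    finally show ?thesis .
  qed
  then show "ereal (3 + s) - 2 * sobolev_index f \<le> ereal z" by (rule ereal_le_epsilon2)
qed

end

lemma in_sobolev_mono:
  assumes "in_sobolev r f" "q \<le> r"
  shows "in_sobolev q f"
  unfolding in_sobolev_def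
proof (rule summable_on_comparison_test[OF assms(1)[unfolded in_sobolev_def]])
  show "bracket m powr (2 * q) * (norm (fourier_coeff f m))\<^sup>2 \<le> bracket m powr (2 * r) * (norm (fourier_coeff f m))\<^sup>2" for m
    using assms(2) bracket_ge_1[of m] by (intro mult_right_mono powr_mono) auto
qed auto

theorem theorem6p4:
  fixes s C :: real and f :: "real \<times> real \<Rightarrow> complex"
  assumes "0 < s" and "s < 1"
    and "torus_L1 f"
    and "\<And>m. norm (fourier_coeff f m) \<le> C / bracket m powr (1 + s)"
    and "\<And>m. norm (sigma1 f m) \<le> C / bracket m powr (2 + s)"
    and "\<And>m. norm (sigma2 f m) \<le> C / bracket m powr (2 + s)"
    and "\<And>m. norm (sigma f m) \<le> C / bracket m powr (3 + s)"
  shows "(AE t in lborel. (\<forall>\<gamma>. 0 < \<gamma> \<and> \<gamma> < s \<longrightarrow> torus_Holder \<gamma> (evolution f t)) \<and>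
            dim_t t f \<le> ereal (3 - s))
       \<and> (AE t in lborel. continuous_on UNIV (evolution f t) \<longrightarrow>
            dim_t t f \<ge> ereal (3 + s) - 2 * sobolev_index f)
       \<and> (s = 1 / 2 \<and> \<not> in_sobolev (1 / 2) f \<longrightarrow>
            (AE t in lborel. dim_t t f = ereal (5 / 2)))"
proof -
  \<comment> \<open>All claims share one exceptional null set, that of the quadratic sum
    bounds.\<close>
  have "AE t in lborel. (\<forall>\<gamma>. 0 < \<gamma> \<and> \<gamma> < s \<longrightarrow> torus_Holder \<gamma> (evolution f t)) \<and>
      dim_t t f \<le> ereal (3 - s) \<and> ereal (3 + s) - 2 * sobolev_index f \<le> dim_t t f"
    using AE_weyl_bound_all
  proof eventually_elim
    case (elim t)
    interpret weyl_series "fourier_coeff f" s C t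
    proof
      show "norm (fourier_coeff f (m1 + 1, m2) - fourier_coeff f (m1, m2)) \<le> C / bracket (m1, m2) powr (2 + s)" for m1 m2
        using assms(5)[of "(m1, m2)"] by (simp add: sigma1_def)
      show "norm (fourier_coeff f (m1, m2 + 1) - fourier_coeff f (m1, m2)) \<le> C / bracket (m1, m2) powr (2 + s)" for m1 m2
        using assms(6)[of "(m1, m2)"] by (simp add: sigma2_def)
      show "norm (fourier_coeff f (m1 + 1, m2 + 1) - fourier_coeff f (m1 + 1, m2) - fourier_coeff f (m1, m2 + 1)
          + fourier_coeff f (m1, m2)) \<le> C / bracket (m1, m2) powr (3 + s)" for m1 m2
        using assms(7)[of "(m1, m2)"] by (simp add: sigma_def)
    qed (use assms elim in auto)
    have ev: "evolution f t = limit" by (rule evolution_eq_limit) simp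
    have "torus_Holder \<gamma> limit" if "0 < \<gamma>" "\<gamma> < s" for \<gamma>
      using Holder_limit[OF that] torus_periodic_limit unfolding torus_Holder_def by metis
    then show ?case
      unfolding dim_t_def ev using fractal_dim_limit_le fractal_dim_limit_ge[OF refl] by auto
  qed note main = this
  \<comment> \<open>Outside H^(1/2) the Sobolev index is at most 1/2, since the spaces decrease in
    r. The lower bound is then 3 + 1/2 - 1, which meets the upper bound 3 - 1/2.\<close>
  have half: "dim_t t f = ereal (5 / 2)"
    if "s = 1 / 2" "\<not> in_sobolev (1 / 2) f" "dim_t t f \<le> ereal (3 - s)" "ereal (3 + s) - 2 * sobolev_index f \<le> dim_t t f" for t
  proof (rule antisym)
    show "dim_t t f \<le> ereal (5 / 2)" using that(3) unfolding that(1) by simp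
    have "r \<le> 1 / 2" if "in_sobolev r f" for r
      using in_sobolev_mono[OF that, of "1 / 2"] \<open>\<not> in_sobolev (1 / 2) f\<close> by linarith
    then have "sobolev_index f \<le> ereal (1 / 2)" unfolding sobolev_index_def by (intro Sup_least) auto
    then have "2 * sobolev_index f \<le> 2 * ereal (1 / 2)" by (rule ereal_mult_left_mono) simp
    then have "ereal (3 + s) - 2 * ereal (1 / 2) \<le> ereal (3 + s) - 2 * sobolev_index f"
      by (intro ereal_minus_mono) auto
    also note that(4)
    finally show "ereal (5 / 2) \<le> dim_t t f" unfolding that(1) by simp
  qed
  show ?thesis
  proof (intro conjI impI)
    show "AE t in lborel. (\<forall>\<gamma>. 0 < \<gamma> \<and> \<gamma> < s \<longrightarrow> torus_Holder \<gamma> (evolution f t)) \<and> dim_t t f \<le> ereal (3 - s)"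
      using main by eventually_elim blast
    show "AE t in lborel. continuous_on UNIV (evolution f t) \<longrightarrow> dim_t t f \<ge> ereal (3 + s) - 2 * sobolev_index f"
      using main by eventually_elim blast
    assume "s = 1 / 2 \<and> \<not> in_sobolev (1 / 2) f"
    then have s: "s = 1 / 2" "\<not> in_sobolev (1 / 2) f" by auto
    show "AE t in lborel. dim_t t f = ereal (5 / 2)"
      using main
    proof eventually_elim
      case (elim t)
      then show ?case by (intro half s) auto
    qed
  qed
qed

end
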